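(* Let $\mathcal{H}$ be a separable Hilbert function space on a non-empty set $X$ such that the reproducing kernel of $\mathcal{H}$ is a normalized complete Pick kernel. Then $$\mathcal{H}\odot\mathcal{H}\subseteq N^+(\mathcal{H}\odot\mathcal{H}),$$ where $$N^+(\mathcal{H}\odot\mathcal{H})=\Big\{\frac{\varphi}{\psi}:\varphi\in\operatorname{Mult}(\mathcal{H}\odot\mathcal{H}),\ \psi\in\operatorname{Mult}(\mathcal{H}),\ \psi\text{ cyclic in }\mathcal{H}\Big\}.$$
   Context: A Hilbert (Banach) function space on a set $X$ is a Hilbert (Banach) space $\mathcal{B}$ of complex-valued functions on $X$ such that each point evaluation $f\mapsto f(w)$, $w\in X$, is bounded on $\mathcal{B}$. Its multipliers are $\operatorname{Mult}(\mathcal{B})=\{\varphi:X\to\mathbb{C}:\varphi\mathcal{B}\subseteq\mathcal{B}\}$, normed by the operator norm of $M_\varphi:f\mapsto\varphi f$. A function $f\in\mathcal{B}$ is cyclic in $\mathcal{B}$ if $\{\varphi f:\varphi\in\operatorname{Mult}(\mathcal{B})\}$ is dense in $\mathcal{B}$. The reproducing kernel $k$ of a Hilbert function space $\mathcal{H}$ satisfies $f(w)=\langle f,k_w\rangle$, $k_w(z)=k(z,w)$. A normalized complete Pick kernel is a reproducing kernel such that $k_{z_0}=1$ for some $z_0\in X$ and $k_w(z)=\frac{1}{1-u_w(z)}$, where $u_w(z)$ is positive definite, i.e. $\sum_{i,j}a_i\overline{a_j}u_{z_j}(z_i)\ge 0$ for all $n\in\mathbb{N}$, $z_1,\dots,z_n\in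 X$, $a_1,\dots,a_n\in\mathbb{C}$. The weak product is $\mathcal{H}\odot\mathcal{H}=\{\sum_{i=1}^\infty f_ig_i: f_i,g_i\in\mathcal{H},\ \sum_i\|f_i\|\|g_i\|<\infty\}$ with norm $\|h\|_{\mathcal{H}\odot\mathcal{H}}=\inf\{\sum_i\|f_i\|\|g_i\|: h=\sum_i f_ig_i\}$; it is a Banach function space on $X$. *)

theory Defs
  imports "HOL-Analysis.Analysis"
begin

text \<open>
  The underlying non-empty set is the type \<open>'x\<close>. A space of functions on it is given by
  its carrier together with a norm or an inner product, of which only the values on the carrier
  are meaningful. The guard in the distance makes it nonnegative and symmetric also outside the
  carrier, as the library locale \<open>Metric_space\<close> demands.
\<close>

definition norm_dist ::
  "('x \<Rightarrow> complex) set \<Rightarrow> (('x \<Rightarrow> complex) \<Rightarrow> real) \<Rightarrow> ('x \<Rightarrow> complex) \<Rightarrow> ('x \<Rightarrow> complex) \<Rightarrow> real"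
  where "norm_dist B N f g = (if f \<in> B \<and> g \<in> B then N (\<lambda>x. f x - g x) else 0)"

definition norm_topology ::
  "('x \<Rightarrow> complex) set \<Rightarrow> (('x \<Rightarrow> complex) \<Rightarrow> real) \<Rightarrow> ('x \<Rightarrow> complex) topology"
  where "norm_topology B N = Metric_space.mtopology B (norm_dist B N)"

definition norm_dense ::
  "('x \<Rightarrow> complex) set \<Rightarrow> (('x \<Rightarrow> complex) \<Rightarrow> real) \<Rightarrow> ('x \<Rightarrow> complex) set \<Rightarrow> bool"
  where "norm_dense B N D \<longleftrightarrow> D \<subseteq> B \<and> norm_topology B N closure_of D = B"

definition norm_separable ::
  "('x \<Rightarrow> complex) set \<Rightarrow> (('x \<Rightarrow> complex) \<Rightarrow> real) \<Rightarrow> bool"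
  where "norm_separable B N \<longleftrightarrow> (\<exists>D. countable D \<and> norm_dense B N D)"

definition Mult :: "('x \<Rightarrow> complex) set \<Rightarrow> ('x \<Rightarrow> complex) set"
  where "Mult B = {\<phi>. \<forall>f\<in>B. (\<lambda>x. \<phi> x * f x) \<in> B}"

definition cyclic ::
  "('x \<Rightarrow> complex) set \<Rightarrow> (('x \<Rightarrow> complex) \<Rightarrow> real) \<Rightarrow> ('x \<Rightarrow> complex) \<Rightarrow> bool"
  where "cyclic B N f \<longleftrightarrow> f \<in> B \<and> norm_dense B N {(\<lambda>x. \<phi> x * f x) | \<phi>. \<phi> \<in> Mult B}"

definition hnorm ::
  "(('x \<Rightarrow> complex) \<Rightarrow> ('x \<Rightarrow> complex) \<Rightarrow> complex) \<Rightarrow> ('x \<Rightarrow> complex) \<Rightarrow> real"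
  where "hnorm ip f = sqrt (Re (ip f f))"

locale hilbert_function_space =
  fixes H :: "('x \<Rightarrow> complex) set"
    and ip :: "('x \<Rightarrow> complex) \<Rightarrow> ('x \<Rightarrow> complex) \<Rightarrow> complex"
  assumes zero_mem: "(\<lambda>x. 0) \<in> H"
    and add_mem: "\<And>f g. f \<in> H \<Longrightarrow> g \<in> H \<Longrightarrow> (\<lambda>x. f x + g x) \<in> H"
    and scale_mem: "\<And>c f. f \<in> H \<Longrightarrow> (\<lambda>x. c * f x) \<in> H"
    and ip_add: "\<And>f g h. f \<in> H \<Longrightarrow> g \<in> H \<Longrightarrow> h \<in> H \<Longrightarrow> ip (\<lambda>x. f x + g x) h = ip f h + ip g h"
    and ip_scale: "\<And>c f h. f \<in> H \<Longrightarrow> h \<in> H \<Longrightarrow> ip (\<lambda>x. c * f x) h = c * ip f h"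
    and ip_cnj: "\<And>f g. f \<in> H \<Longrightarrow> g \<in> H \<Longrightarrow> ip g f = cnj (ip f g)"
    and ip_nonneg: "\<And>f. f \<in> H \<Longrightarrow> ip f f \<in> \<real>\<^sub>\<ge>\<^sub>0"
    and ip_definite: "\<And>f. f \<in> H \<Longrightarrow> ip f f = 0 \<Longrightarrow> f = (\<lambda>x. 0)"
    and complete: "Metric_space.mcomplete H (norm_dist H (hnorm ip))"
    and bounded_eval: "\<And>w. \<exists>C. \<forall>f\<in>H. cmod (f w) \<le> C * hnorm ip f"
begin

lemma diff_mem:
  assumes "f \<in> H" "g \<in> H"
  shows "(\<lambda>x. f x - g x) \<in> H"
  using add_mem[OF assms(1) scale_mem[OF assms(2), of "-1"]] by simp

lemma Re_ip_self_nonneg: "f \<in> H \<Longrightarrow> 0 \<le> Re (ip f f)"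
  using ip_nonneg[of f] by (auto simp: nonneg_Reals_def)

lemma Re_ip_self_eq_0: "f \<in> H \<Longrightarrow> Re (ip f f) = 0 \<Longrightarrow> f = (\<lambda>x. 0)"
  using ip_nonneg[of f] ip_definite[of f] by (auto simp: nonneg_Reals_def)

lemma ip_zero: "f \<in> H \<Longrightarrow> ip (\<lambda>x. 0) f = 0"
  using ip_scale[of f f 0] by simp

lemma Re_ip_add_scaled:
  assumes f: "f \<in> H" and g: "g \<in> H"
  shows "Re (ip (\<lambda>x. f x + of_real t * g x) (\<lambda>x. f x + of_real t * g x)) =
    Re (ip f f) + 2 * t * Re (ip f g) + t\<^sup>2 * Re (ip g g)"
proof -
  let ?g = "\<lambda>x. of_real t * g x" and ?h = "\<lambda>x. f x + of_real t * g x"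
  have m: "?g \<in> H" "?h \<in> H" using f g by (auto intro: add_mem scale_mem)
  have r: "ip u ?h = ip u f + of_real t * ip u g" if "u \<in> H" for u
    using ip_cnj[OF m(2) that] ip_cnj[OF f that] ip_cnj[OF g that]
      ip_add[OF f m(1) that] ip_scale[OF g that, of "of_real t"] by simp
  have "ip ?h ?h = ip f f + of_real t * ip f g + of_real t * (ip g f + of_real t * ip g g)"
    using ip_add[OF f m(1) m(2)] ip_scale[OF g m(2), of "of_real t"] r f g by simp
  moreover have "Re (ip g f) = Re (ip f g)" using ip_cnj[OF f g] by simp
  ultimately show ?thesis by (simp add: algebra_simps power2_eq_square)
qed

lemma hnorm_triangle:
  assumes f: "f \<in> H" and g: "g \<in> H"
  shows "hnorm ip (\<lambda>x. f x + g x) \<le> hnorm ip f + hnorm ip g"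
proof -
  define a b c where "a = Re (ip f f)" and "b = Re (ip f g)" and "c = Re (ip g g)"
  have q: "0 \<le> a + 2 * t * b + t\<^sup>2 * c" for t
    using Re_ip_add_scaled[OF f g, of t] Re_ip_self_nonneg[OF add_mem[OF f scale_mem[OF g, of "of_real t"]]]
    by (simp add: a_def b_def c_def)
  have nn: "0 \<le> a" "0 \<le> c" using f g Re_ip_self_nonneg by (auto simp: a_def c_def)
  have cs: "b\<^sup>2 \<le> a * c"
  proof (cases "c = 0")
    case True
    then have "g = (\<lambda>x. 0)" using Re_ip_self_eq_0[OF g] by (simp add: c_def)
    then have "b = 0" using ip_cnj[OF g f] ip_zero[OF f] by (simp add: b_def)
    then show ?thesis using True by simp
  next
    case False
    then have "a + 2 * (- b / c) * b + (- b / c)\<^sup>2 * c = a - b\<^sup>2 / c"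
      by (simp add: field_simps power2_eq_square)
    then have "b\<^sup>2 / c \<le> a" using q[of "- b / c"] by simp
    then show ?thesis using False nn by (simp add: field_simps)
  qed
  have "b \<le> sqrt a * sqrt c"
    using real_le_rsqrt[OF cs] by (simp add: real_sqrt_mult)
  then have "a + 2 * b + c \<le> (sqrt a + sqrt c)\<^sup>2"
    using nn by (simp add: power2_sum)
  then have "sqrt (a + 2 * b + c) \<le> sqrt a + sqrt c"
    by (rule real_le_lsqrt[rotated]) (use nn in simp)
  then show ?thesis
    using Re_ip_add_scaled[OF f g, of 1] by (simp add: hnorm_def a_def b_def c_def)
qed

sublocale Metric_space H "norm_dist H (hnorm ip)"
proof
  fix f g h
  show "0 \<le> norm_dist H (hnorm ip) f g"
    by (simp add: norm_dist_def hnorm_def Re_ip_self_nonneg diff_mem)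
  show "norm_dist H (hnorm ip) f g = norm_dist H (hnorm ip) g f"
  proof (cases "f \<in> H \<and> g \<in> H")
    case True
    then have d: "(\<lambda>x. f x - g x) \<in> H" by (simp add: diff_mem)
    have "(\<lambda>x. g x - f x) = (\<lambda>x. 0 + of_real (-1) * (f x - g x))" by auto
    then show ?thesis
      using Re_ip_add_scaled[OF zero_mem d, of "-1"] True ip_zero[OF d] ip_zero[OF zero_mem]
      by (simp add: norm_dist_def hnorm_def)
  qed (auto simp: norm_dist_def)
  assume f: "f \<in> H" and g: "g \<in> H"
  have fg: "(\<lambda>x. f x - g x) \<in> H" using f g by (rule diff_mem)
  have "hnorm ip (\<lambda>x. f x - g x) = 0 \<longleftrightarrow> f = g"
  proof
    assume "hnorm ip (\<lambda>x. f x - g x) = 0"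
    then have "Re (ip (\<lambda>x. f x - g x) (\<lambda>x. f x - g x)) = 0" by (simp add: hnorm_def)
    then have "(\<lambda>x. f x - g x) = (\<lambda>x. 0)" by (rule Re_ip_self_eq_0[OF fg])
    then show "f = g" by (simp add: fun_eq_iff)
  next
    assume "f = g"
    then show "hnorm ip (\<lambda>x. f x - g x) = 0"
      using ip_zero[OF zero_mem] by (simp add: hnorm_def)
  qed
  then show "norm_dist H (hnorm ip) f g = 0 \<longleftrightarrow> f = g"
    using f g by (simp add: norm_dist_def)
  assume h: "h \<in> H"
  have "hnorm ip (\<lambda>x. f x - h x) \<le> hnorm ip (\<lambda>x. f x - g x) + hnorm ip (\<lambda>x. g x - h x)"
    using hnorm_triangle[OF fg diff_mem[OF g h]] by simp
  then show "norm_dist H (hnorm ip) f h \<le> norm_dist H (hnorm ip) f g + norm_dist H (hnorm ip) g h"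
    using f g h by (simp add: norm_dist_def)
qed

end

text \<open>
  Kernels are written \<open>k z w\<close> for \<open>k(z,w)\<close>, so that \<open>k\<^sub>w = (\<lambda>z. k z w)\<close>;
  the same convention is used for \<open>u z w\<close>, which stands for \<open>u\<^sub>w(z)\<close>.
\<close>

definition reproducing_kernel ::
  "('x \<Rightarrow> complex) set \<Rightarrow> (('x \<Rightarrow> complex) \<Rightarrow> ('x \<Rightarrow> complex) \<Rightarrow> complex) \<Rightarrow> ('x \<Rightarrow> 'x \<Rightarrow> complex) \<Rightarrow> bool"
  where "reproducing_kernel H ip k \<longleftrightarrow>
    (\<forall>w. (\<lambda>z. k z w) \<in> H \<and> (\<forall>f\<in>H. f w = ip f (\<lambda>z. k z w)))"

definition positive_definite :: "('x \<Rightarrow> 'x \<Rightarrow> complex) \<Rightarrow> bool"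
  where "positive_definite u \<longleftrightarrow>
    (\<forall>(n::nat) (z :: nat \<Rightarrow> 'x) (a :: nat \<Rightarrow> complex).
      (\<Sum>i<n. \<Sum>j<n. a i * cnj (a j) * u (z i) (z j)) \<in> \<real>\<^sub>\<ge>\<^sub>0)"

text \<open>The conjunct \<open>u z w \<noteq> 1\<close> excludes the convention \<open>1 / 0 = 0\<close>.\<close>

definition normalized_complete_Pick :: "('x \<Rightarrow> 'x \<Rightarrow> complex) \<Rightarrow> bool"
  where "normalized_complete_Pick k \<longleftrightarrow>
    (\<exists>z0. \<forall>z. k z z0 = 1) \<and>
    (\<exists>u. positive_definite u \<and> (\<forall>z w. u z w \<noteq> 1 \<and> k z w = 1 / (1 - u z w)))"

text \<open>
  The series is meant pointwise; by boundedness of the point evaluations the summability condition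
  makes it converge absolutely at every point. The norm of the weak product is not needed to
  define its multipliers.
\<close>

definition weak_product ::
  "('x \<Rightarrow> complex) set \<Rightarrow> (('x \<Rightarrow> complex) \<Rightarrow> ('x \<Rightarrow> complex) \<Rightarrow> complex) \<Rightarrow> ('x \<Rightarrow> complex) set"
  where "weak_product H ip = {h. \<exists>f g :: nat \<Rightarrow> 'x \<Rightarrow> complex.
    (\<forall>i. f i \<in> H \<and> g i \<in> H) \<and>
    summable (\<lambda>i. hnorm ip (f i) * hnorm ip (g i)) \<and>
    (\<forall>x. (\<lambda>i. f i x * g i x) sums h x)}"

text \<open>
  If \<open>H\<close> contains the constant function 1, as it does when its kernel is normalized, then a
  function cyclic in \<open>H\<close> has no zeros, so the quotients below are genuine quotients.
\<close>

definition Nplus_weak_product ::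
  "('x \<Rightarrow> complex) set \<Rightarrow> (('x \<Rightarrow> complex) \<Rightarrow> ('x \<Rightarrow> complex) \<Rightarrow> complex) \<Rightarrow> ('x \<Rightarrow> complex) set"
  where "Nplus_weak_product H ip =
    {(\<lambda>x. \<phi> x / \<psi> x) | \<phi> \<psi>.
      \<phi> \<in> Mult (weak_product H ip) \<and> \<psi> \<in> Mult H \<and> cyclic H (hnorm ip) \<psi>}"

end

theory Submission
  imports Defs
begin

text \<open>
  Given \<open>F\<^sub>n\<close> in \<open>H\<close> with \<open>F\<^sub>0 = 1\<close> and \<open>(\<Sum>n. \<parallel>F\<^sub>n\<parallel>\<^sup>2) < \<infinity>\<close>, put
  \<open>V w = (\<Sum>n. 2 \<langle>F\<^sub>n, k\<^sub>w F\<^sub>n\<rangle> - \<parallel>F\<^sub>n\<parallel>\<^sup>2)\<close>. Since \<open>k (1 - u) = 1\<close>, Schur's product theorem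
  gives \<open>Re \<langle>V t, t\<rangle> \<ge> (\<Sum>n. \<parallel>F\<^sub>n t\<parallel>\<^sup>2)\<close> for \<open>t\<close> in the span of the kernels. Applied to the
  adjoints of multiplication operators, this makes the column \<open>(F\<^sub>n / V)\<^sub>n\<close> a contractive
  multiplier. So the \<open>F\<^sub>n\<close> have the common denominator \<open>1 / V\<close>, which is accretive, and an
  accretive operator with trivial kernel has dense range.
  For \<open>h = (\<Sum>n. f\<^sub>n g\<^sub>n)\<close>, scaled so that \<open>\<parallel>f\<^sub>n\<parallel> = \<parallel>g\<^sub>n\<parallel>\<close>, the product of the denominators of the
  two sequences is cyclic, and by the column bounds its product with \<open>h\<close> multiplies the weak
  product into itself.
\<close>

section \<open>Hilbert function spaces\<close>

context hilbert_function_space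
begin

abbreviation nrm :: "('x \<Rightarrow> complex) \<Rightarrow> real"
  where "nrm \<equiv> hnorm ip"

lemma sum_mem: "(\<And>i. i \<in> I \<Longrightarrow> f i \<in> H) \<Longrightarrow> (\<lambda>x. \<Sum>i\<in>I. f i x) \<in> H"
  by (induction I rule: infinite_finite_induct) (auto simp: zero_mem intro: add_mem)

lemma ip_add_right:
  assumes "f \<in> H" "g \<in> H" "h \<in> H"
  shows "ip f (\<lambda>x. g x + h x) = ip f g + ip f h"
proof -
  have "ip f (\<lambda>x. g x + h x) = cnj (ip (\<lambda>x. g x + h x) f)"
    using assms by (intro ip_cnj add_mem)
  also have "\<dots> = cnj (ip g f) + cnj (ip h f)"
    using assms by (simp add: ip_add)
  also have "\<dots> = ip f g + ip f h"
    using assms ip_cnj[of g f] ip_cnj[of h f] by simp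
  finally show ?thesis .
qed

lemma ip_scale_right:
  assumes "f \<in> H" "g \<in> H"
  shows "ip f (\<lambda>x. c * g x) = cnj c * ip f g"
proof -
  have "ip f (\<lambda>x. c * g x) = cnj (ip (\<lambda>x. c * g x) f)"
    using assms by (intro ip_cnj scale_mem)
  also have "\<dots> = cnj c * ip f g"
    using assms ip_cnj[of g f] by (simp add: ip_scale)
  finally show ?thesis .
qed

lemma ip_zero_right: "f \<in> H \<Longrightarrow> ip f (\<lambda>x. 0) = 0"
  using ip_scale_right[of f f 0] by simp

lemma ip_diff:
  assumes "f \<in> H" "g \<in> H" "h \<in> H"
  shows "ip (\<lambda>x. f x - g x) h = ip f h - ip g h"
  using ip_add[OF assms(1) scale_mem[OF assms(2), of "-1"] assms(3)] ip_scale[OF assms(2,3), of "-1"]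
  by simp

lemma ip_diff_right:
  assumes "f \<in> H" "g \<in> H" "h \<in> H"
  shows "ip f (\<lambda>x. g x - h x) = ip f g - ip f h"
  using ip_add_right[OF assms(1,2) scale_mem[OF assms(3), of "-1"]]
    ip_scale_right[OF assms(1,3), of "-1"]
  by simp

lemma ip_sum:
  assumes "\<And>i. i \<in> I \<Longrightarrow> f i \<in> H" "g \<in> H"
  shows "ip (\<lambda>x. \<Sum>i\<in>I. f i x) g = (\<Sum>i\<in>I. ip (f i) g)"
  using assms(1)
proof (induction I rule: infinite_finite_induct)
  case (insert i I)
  then show ?case
    using ip_add[of "f i" "\<lambda>x. \<Sum>i\<in>I. f i x" g] sum_mem[of I f] assms(2) by auto
qed (auto simp: ip_zero assms)

lemma ip_sum_right:
  assumes "\<And>i. i \<in> I \<Longrightarrow> g i \<in> H" "f \<in> H"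
  shows "ip f (\<lambda>x. \<Sum>i\<in>I. g i x) = (\<Sum>i\<in>I. ip f (g i))"
  using assms(1)
proof (induction I rule: infinite_finite_induct)
  case (insert i I)
  then show ?case
    using ip_add_right[of f "g i" "\<lambda>x. \<Sum>i\<in>I. g i x"] sum_mem[of I g] assms(2) by auto
qed (auto simp: ip_zero_right assms)

lemma nrm_nonneg: "f \<in> H \<Longrightarrow> 0 \<le> nrm f"
  by (simp add: hnorm_def Re_ip_self_nonneg)

lemma nrm_sq: "f \<in> H \<Longrightarrow> (nrm f)\<^sup>2 = Re (ip f f)"
  by (simp add: hnorm_def Re_ip_self_nonneg)

lemma ip_self: "f \<in> H \<Longrightarrow> ip f f = of_real ((nrm f)\<^sup>2)"
  using ip_nonneg[of f] nrm_sq[of f] by (auto simp: nonneg_Reals_def)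

lemma nrm_eq_0: "f \<in> H \<Longrightarrow> nrm f = 0 \<Longrightarrow> f = (\<lambda>x. 0)"
  using nrm_sq[of f] Re_ip_self_eq_0[of f] by simp

lemma nrm_zero: "nrm (\<lambda>x. 0) = 0"
  by (simp add: hnorm_def ip_zero zero_mem)

lemma nrm_scale:
  assumes "f \<in> H"
  shows "nrm (\<lambda>x. c * f x) = cmod c * nrm f"
proof -
  have "ip (\<lambda>x. c * f x) (\<lambda>x. c * f x) = (c * cnj c) * ip f f"
    using assms by (simp add: ip_scale ip_scale_right scale_mem)
  also have "\<dots> = of_real ((cmod c)\<^sup>2 * (nrm f)\<^sup>2)"
    using assms by (simp add: ip_self flip: complex_norm_square)
  finally have "(nrm (\<lambda>x. c * f x))\<^sup>2 = (cmod c * nrm f)\<^sup>2"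
    using assms by (simp add: nrm_sq scale_mem power_mult_distrib)
  then show ?thesis
    using assms by (simp add: nrm_nonneg scale_mem)
qed

lemma nrm_sq_add_scaled:
  assumes "f \<in> H" "g \<in> H"
  shows "(nrm (\<lambda>x. f x + of_real t * g x))\<^sup>2 = (nrm f)\<^sup>2 + 2 * t * Re (ip f g) + t\<^sup>2 * (nrm g)\<^sup>2"
  using Re_ip_add_scaled[OF assms, of t] assms by (simp add: nrm_sq add_mem scale_mem)

lemma nrm_sq_add:
  assumes "f \<in> H" "g \<in> H"
  shows "(nrm (\<lambda>x. f x + g x))\<^sup>2 = (nrm f)\<^sup>2 + 2 * Re (ip f g) + (nrm g)\<^sup>2"
  using nrm_sq_add_scaled[OF assms, of 1] by simp

lemma nrm_sq_diff:
  assumes "f \<in> H" "g \<in> H"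
  shows "(nrm (\<lambda>x. f x - g x))\<^sup>2 = (nrm f)\<^sup>2 - 2 * Re (ip f g) + (nrm g)\<^sup>2"
  using nrm_sq_add_scaled[OF assms, of "-1"] by simp

lemma nrm_minus_commute: "f \<in> H \<Longrightarrow> g \<in> H \<Longrightarrow> nrm (\<lambda>x. f x - g x) = nrm (\<lambda>x. g x - f x)"
  using nrm_scale[OF diff_mem[of f g], of "-1"] by simp

lemma two_Re_ip_le:
  assumes "f \<in> H" "g \<in> H"
  shows "2 * Re (ip f g) \<le> (nrm f)\<^sup>2 + (nrm g)\<^sup>2"
  using nrm_sq_diff[OF assms] zero_le_power2[of "nrm (\<lambda>x. f x - g x)"] by linarith

lemma Cauchy_Schwarz:
  assumes f: "f \<in> H" and g: "g \<in> H"
  shows "cmod (ip f g) \<le> nrm f * nrm g"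
proof -
  have re: "Re (ip h g) \<le> nrm h * nrm g" if h: "h \<in> H" for h
  proof -
    have "(nrm (\<lambda>x. h x + g x))\<^sup>2 \<le> (nrm h + nrm g)\<^sup>2"
      using hnorm_triangle[OF h g] nrm_nonneg[OF add_mem[OF h g]] by (rule power_mono)
    then show ?thesis
      using nrm_sq_add[OF h g] by (simp add: power2_sum)
  qed
  \<comment> \<open>Rotating \<open>f\<close> by \<open>c\<close> turns the bound on real parts into
    one on moduli. Since \<open>sgn 0 = 0\<close>, only \<open>cmod c \<le> 1\<close> is available,
    which suffices.\<close>
  define c where "c = cnj (sgn (ip f g))"
  have "c * ip f g = of_real (cmod (ip f g))"
  proof (cases "ip f g = 0")
    case False
    have "c * ip f g = ip f g * cnj (ip f g) / of_real (cmod (ip f g))"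
      by (simp add: c_def sgn_eq)
    also have "\<dots> = of_real ((cmod (ip f g))\<^sup>2) / of_real (cmod (ip f g))"
      by (simp flip: complex_norm_square)
    finally show ?thesis using False by (simp add: power2_eq_square)
  qed simp
  then have "cmod (ip f g) = Re (ip (\<lambda>x. c * f x) g)"
    using f g by (simp add: ip_scale)
  also have "\<dots> \<le> cmod c * nrm f * nrm g"
    using re[OF scale_mem[OF f]] by (simp add: nrm_scale f)
  also have "cmod c \<le> 1"
    by (simp add: c_def norm_sgn)
  then have "cmod c * nrm f * nrm g \<le> nrm f * nrm g"
    using nrm_nonneg f g by (simp add: mult_left_le_one_le mult_right_mono)
  finally show ?thesis .
qed

text \<open>
  The functional is given by its graph \<open>R\<close>, which spares the well-definedness check. As usual,
  \<open>F\<close> is the limit of a sequence minimising \<open>\<parallel>g\<parallel>\<^sup>2 - 2 Re c\<close> over \<open>(g, c) \<in> R\<close>.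
\<close>

lemma Riesz:
  assumes R_mem: "\<And>g c. (g, c) \<in> R \<Longrightarrow> g \<in> H"
    and R_zero: "(\<lambda>x. 0, 0) \<in> R"
    and R_add: "\<And>f b g c. (f, b) \<in> R \<Longrightarrow> (g, c) \<in> R \<Longrightarrow> (\<lambda>x. f x + g x, b + c) \<in> R"
    and R_scale: "\<And>g c s. (g, c) \<in> R \<Longrightarrow> (\<lambda>x. s * g x, s * c) \<in> R"
    and R_bound: "\<And>g c. (g, c) \<in> R \<Longrightarrow> cmod c \<le> C * nrm g"
  shows "\<exists>F\<in>H. (\<forall>g c. (g, c) \<in> R \<longrightarrow> ip g F = c) \<and>
    (\<forall>e>0. \<exists>g c. (g, c) \<in> R \<and> nrm (\<lambda>x. F x - g x) < e)"
proof -
  define J where "J = (\<lambda>(g, c). (nrm g)\<^sup>2 - 2 * Re c)"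
  have low: "- C\<^sup>2 \<le> J p" if "p \<in> R" for p
  proof -
    obtain g c where p: "p = (g, c)" by (cases p)
    have "Re c \<le> C * nrm g"
      using R_bound[of g c] complex_Re_le_cmod[of c] that p by simp
    moreover have "0 \<le> (nrm g - C)\<^sup>2" by simp
    ultimately show ?thesis
      unfolding p J_def by (simp add: power2_diff mult.commute mult.left_commute)
  qed
  define m where "m = Inf (J ` R)"
  have bdd: "bdd_below (J ` R)"
    using low by (rule bdd_belowI2)
  have m_le: "m \<le> J p" if "p \<in> R" for p
    unfolding m_def using bdd that by (intro cInf_lower) auto
  have "\<exists>p\<in>R. J p < m + e" if "0 < e" for e
    using cInf_lessD[of "J ` R" "m + e"] R_zero that unfolding m_def by auto
  then have "\<forall>n. \<exists>p\<in>R. J p < m + inverse (Suc n)" by simp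
  then obtain P where P: "\<And>n. P n \<in> R" "\<And>n. J (P n) < m + inverse (Suc n)" by metis
  define s where "s n = fst (P n)" for n
  define d where "d n = snd (P n)" for n
  have sd: "(s n, d n) \<in> R" for n using P(1)[of n] by (simp add: s_def d_def)
  have sH: "s n \<in> H" for n using R_mem sd .
  have Js: "(nrm (s n))\<^sup>2 - 2 * Re (d n) < m + inverse (Suc n)" for n
    using P(2)[of n] by (simp add: J_def s_def d_def split_beta)
  \<comment> \<open>The midpoint of two members of \<open>R\<close> is again in \<open>R\<close>, so
    its \<open>J\<close> is at least \<open>m\<close>. With the parallelogram law this makes the
    minimising sequence Cauchy.\<close>
  have near: "(nrm (\<lambda>x. s i x - s j x))\<^sup>2 \<le> 2 * inverse (Suc i) + 2 * inverse (Suc j)" for i j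
  proof -
    have "(\<lambda>x. (1/2) * (s i x + s j x), (1/2) * (d i + d j)) \<in> R"
      using R_scale R_add sd by blast
    from m_le[OF this] have "m \<le> (nrm (\<lambda>x. s i x + s j x))\<^sup>2 / 4 - Re (d i) - Re (d j)"
      unfolding J_def prod.case nrm_scale[OF add_mem[OF sH[of i] sH[of j]]] power_mult_distrib
      by (simp add: power_divide add_divide_distrib)
    moreover have "(nrm (\<lambda>x. s i x - s j x))\<^sup>2 + (nrm (\<lambda>x. s i x + s j x))\<^sup>2
        = 2 * (nrm (s i))\<^sup>2 + 2 * (nrm (s j))\<^sup>2"
      by (simp add: nrm_sq_add nrm_sq_diff sH)
    ultimately show ?thesis using Js[of i] Js[of j] by linarith
  qed
  have "MCauchy s"
    unfolding MCauchy_def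
  proof (intro conjI allI impI)
    show "range s \<subseteq> H" using sH by auto
    fix e :: real assume e: "0 < e"
    then obtain N where N: "inverse (Suc N) < e\<^sup>2 / 4"
      using reals_Archimedean[of "e\<^sup>2 / 4"] by auto
    show "\<exists>N. \<forall>n n'. N \<le> n \<longrightarrow> N \<le> n' \<longrightarrow> norm_dist H nrm (s n) (s n') < e"
    proof (intro exI allI impI)
      fix i j assume "N \<le> i" "N \<le> j"
      then have "inverse (real (Suc i)) \<le> inverse (real (Suc N))"
        "inverse (real (Suc j)) \<le> inverse (real (Suc N))"
        by (auto intro!: le_imp_inverse_le)
      then have "(nrm (\<lambda>x. s i x - s j x))\<^sup>2 < e\<^sup>2"
        using near[of i j] N by linarith
      then have "nrm (\<lambda>x. s i x - s j x) < e"
        using e by (intro power2_less_imp_less[of _ e]) auto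
      then show "norm_dist H nrm (s i) (s j) < e" by (simp add: norm_dist_def sH)
    qed
  qed
  then obtain F where F: "limitin mtopology s F sequentially"
    using complete unfolding mcomplete_def by blast
  then have FH: "F \<in> H" and Fe: "\<And>e. 0 < e \<Longrightarrow> \<forall>\<^sub>F n in sequentially. s n \<in> H \<and> norm_dist H nrm (s n) F < e"
    unfolding limitin_metric by auto
  have lim0: "(\<lambda>n. nrm (\<lambda>x. s n x - F x)) \<longlonglongrightarrow> 0"
  proof (rule tendstoI)
    fix e :: real assume "0 < e"
    from Fe[OF this] show "\<forall>\<^sub>F n in sequentially. dist (nrm (\<lambda>x. s n x - F x)) 0 < e"
      by eventually_elim (simp add: norm_dist_def FH sH nrm_nonneg diff_mem)
  qed
  have re: "Re (ip g F) = Re c" if gc: "(g, c) \<in> R" for g c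
  proof -
    have gH: "g \<in> H" using R_mem gc .
    have lim: "(\<lambda>n. Re (ip g (s n))) \<longlonglongrightarrow> Re (ip g F)"
    proof (rule LIM_zero_cancel, rule Lim_null_comparison)
      show "\<forall>\<^sub>F n in sequentially. norm (Re (ip g (s n)) - Re (ip g F)) \<le> nrm g * nrm (\<lambda>x. s n x - F x)"
      proof (intro always_eventually allI)
        fix n
        show "norm (Re (ip g (s n)) - Re (ip g F)) \<le> nrm g * nrm (\<lambda>x. s n x - F x)"
          using Cauchy_Schwarz[OF gH diff_mem[OF sH[of n] FH]] abs_Re_le_cmod[of "ip g (s n) - ip g F"]
          by (simp add: ip_diff_right gH sH FH)
      qed
      show "(\<lambda>n. nrm g * nrm (\<lambda>x. s n x - F x)) \<longlonglongrightarrow> 0"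
        using tendsto_mult_right_zero[OF lim0] .
    qed
    \<comment> \<open>Moving a near-minimiser in the direction \<open>g\<close> cannot bring
      \<open>J\<close> below \<open>m\<close>; the defect \<open>inverse (Suc n)\<close> disappears
      in the limit.\<close>
    have ineq: "0 \<le> 2 * t * (Re (ip g F) - Re c) + t\<^sup>2 * (nrm g)\<^sup>2" for t :: real
    proof (rule LIMSEQ_le_const)
      have "(\<lambda>n. 2 * t * (Re (ip g (s n)) - Re c) + t\<^sup>2 * (nrm g)\<^sup>2 + inverse (Suc n))
        \<longlonglongrightarrow> 2 * t * (Re (ip g F) - Re c) + t\<^sup>2 * (nrm g)\<^sup>2 + 0"
        by (intro tendsto_intros lim LIMSEQ_inverse_real_of_nat)
      then show "(\<lambda>n. 2 * t * (Re (ip g (s n)) - Re c) + t\<^sup>2 * (nrm g)\<^sup>2 + inverse (Suc n))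
        \<longlonglongrightarrow> 2 * t * (Re (ip g F) - Re c) + t\<^sup>2 * (nrm g)\<^sup>2" by simp
      have "0 \<le> 2 * t * (Re (ip g (s n)) - Re c) + t\<^sup>2 * (nrm g)\<^sup>2 + inverse (Suc n)" for n
      proof -
        have "(\<lambda>x. s n x + of_real t * g x, d n + of_real t * c) \<in> R"
          using R_add R_scale sd gc by blast
        from m_le[OF this] have "m \<le> (nrm (s n))\<^sup>2 + 2 * t * Re (ip (s n) g) + t\<^sup>2 * (nrm g)\<^sup>2
            - 2 * Re (d n) - 2 * t * Re c"
          by (simp add: J_def nrm_sq_add_scaled sH gH)
        moreover have "Re (ip (s n) g) = Re (ip g (s n))"
          using ip_cnj[OF gH sH[of n]] by simp
        ultimately have "0 \<le> 2 * t * Re (ip g (s n)) - 2 * t * Re c + t\<^sup>2 * (nrm g)\<^sup>2 + inverse (Suc n)"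
          using Js[of n] by simp
        then show ?thesis by (simp add: algebra_simps)
      qed
      then show "\<exists>N. \<forall>n\<ge>N. 0 \<le> 2 * t * (Re (ip g (s n)) - Re c) + t\<^sup>2 * (nrm g)\<^sup>2 + inverse (real (Suc n))"
        by blast
    qed
    define D where "D = Re (ip g F) - Re c"
    \<comment> \<open>The quadratic in \<open>t\<close> is tested at \<open>- D / G\<close>; the
      added 1 keeps \<open>G\<close> positive also for \<open>g = 0\<close>.\<close>
    define G where "G = (nrm g)\<^sup>2 + 1"
    have G: "0 < G" by (simp add: G_def add_nonneg_pos)
    have "0 \<le> 2 * (- D / G) * D + (- D / G)\<^sup>2 * (nrm g)\<^sup>2"
      using ineq[of "- D / G"] by (simp add: D_def)
    also have "\<dots> \<le> 2 * (- D / G) * D + (- D / G)\<^sup>2 * G"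
      by (simp add: G_def mult_left_mono)
    also have "\<dots> = - (D\<^sup>2 / G)" using G by (simp add: field_simps power2_eq_square)
    finally have "D = 0" using G by (auto simp: divide_le_0_iff)
    then show ?thesis by (simp add: D_def)
  qed
  show ?thesis
  proof (intro bexI[OF _ FH] conjI allI impI)
    fix g c assume gc: "(g, c) \<in> R"
    have gH: "g \<in> H" using R_mem gc .
    have "Re (- \<i> * ip g F) = Re (- \<i> * c)"
      using re[OF R_scale[OF gc, of "-\<i>"]] unfolding ip_scale[OF gH FH] .
    then show "ip g F = c" using re[OF gc] by (simp add: complex_eq_iff)
  next
    fix e :: real assume "0 < e"
    then obtain n where "norm_dist H nrm (s n) F < e"
      using Fe[of e] by (auto simp: eventually_sequentially)
    then have "nrm (\<lambda>x. F x - s n x) < e"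
      by (simp add: norm_dist_def FH sH nrm_minus_commute)
    then show "\<exists>g c. (g, c) \<in> R \<and> nrm (\<lambda>x. F x - g x) < e" using sd by blast
  qed
qed

end

section \<open>Reproducing kernels\<close>

locale kernel_space = hilbert_function_space H ip
  for H :: "('x \<Rightarrow> complex) set" and ip +
  fixes k :: "'x \<Rightarrow> 'x \<Rightarrow> complex"
  assumes kernel: "reproducing_kernel H ip k"
begin

lemma kernel_mem: "(\<lambda>z. k z w) \<in> H"
  and reproducing: "f \<in> H \<Longrightarrow> ip f (\<lambda>z. k z w) = f w"
  using kernel by (auto simp: reproducing_kernel_def)

lemma kernel_cnj: "k z w = cnj (k w z)"
  using ip_cnj[OF kernel_mem[of z] kernel_mem[of w]] unfolding reproducing[OF kernel_mem] .

text \<open>Pairing with such a combination evaluates at the points of \<open>Y\<close>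
  (\<open>ip_kc\<close>), so adjoints of multiplication operators act on the coefficients alone.
  Different coefficients may give the same function.\<close>

definition kc :: "'x set \<Rightarrow> ('x \<Rightarrow> complex) \<Rightarrow> 'x \<Rightarrow> complex"
  where "kc Y a = (\<lambda>z. \<Sum>y\<in>Y. a y * k z y)"

lemma kc_mem: "kc Y a \<in> H"
  unfolding kc_def by (intro sum_mem scale_mem kernel_mem)

lemma ip_kc: "h \<in> H \<Longrightarrow> ip h (kc Y a) = (\<Sum>y\<in>Y. cnj (a y) * h y)"
  by (simp add: kc_def ip_sum_right ip_scale_right scale_mem kernel_mem reproducing)

text \<open>Padding with zeros lets finitely many combinations share one index set.\<close>

lemma kc_mono_neutral:
  assumes "finite Z" "Y \<subseteq> Z"
  shows "kc Z (\<lambda>y. if y \<in> Y then a y else 0) = kc Y a"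
proof (rule ext)
  fix z
  have "(\<Sum>y\<in>Z. (if y \<in> Y then a y else 0) * k z y) = (\<Sum>y\<in>Z. if y \<in> Y then a y * k z y else 0)"
    by (intro sum.cong) auto
  also have "\<dots> = (\<Sum>y\<in>Y. a y * k z y)"
    using assms by (simp add: sum.inter_restrict[symmetric] Int_absorb1)
  finally show "kc Z (\<lambda>y. if y \<in> Y then a y else 0) z = kc Y a z" by (simp add: kc_def)
qed

text \<open>The bound makes \<open>kc Y a \<mapsto> (\<Sum>y\<in>Y. a y * cnj (F y))\<close> a
  bounded functional on the span of the kernels, and testing its Riesz representative on single
  kernels identifies it with \<open>F\<close>. Products are later shown to lie in \<open>H\<close>
  in this way: only the adjoint of the multiplication has to be estimated, and only on the
  span.\<close>

lemma
  assumes bound: "\<And>Y a. finite Y \<Longrightarrow> cmod (\<Sum>y\<in>Y. cnj (a y) * F y) \<le> C * nrm (kc Y a)"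
  shows kernel_Riesz_mem: "F \<in> H"
    and kernel_Riesz_approx: "0 < e \<Longrightarrow> \<exists>Y a. finite Y \<and> nrm (\<lambda>x. F x - kc Y a x) < e"
proof -
  define R where "R = {(kc Y a, \<Sum>y\<in>Y. a y * cnj (F y)) |Y a. finite Y}"
  have R_add: "(\<lambda>x. f x + g x, b + c) \<in> R" if "(f, b) \<in> R" "(g, c) \<in> R" for f b g c
  proof -
    obtain Y a where Y: "finite Y" "f = kc Y a" "b = (\<Sum>y\<in>Y. a y * cnj (F y))"
      using \<open>(f, b) \<in> R\<close> by (auto simp: R_def)
    obtain Z d where Z: "finite Z" "g = kc Z d" "c = (\<Sum>y\<in>Z. d y * cnj (F y))"
      using \<open>(g, c) \<in> R\<close> by (auto simp: R_def)
    \<comment> \<open>Both coefficient families are extended by 0 to \<open>Y \<union> Z\<close>, so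
      that they add up on the overlap.\<close>
    define e where "e y = (if y \<in> Y then a y else 0) + (if y \<in> Z then d y else 0)" for y
    have split: "(\<Sum>y\<in>Y \<union> Z. e y * G y) = (\<Sum>y\<in>Y. a y * G y) + (\<Sum>y\<in>Z. d y * G y)" for G
    proof -
      have "(\<Sum>y\<in>Y \<union> Z. e y * G y)
        = (\<Sum>y\<in>Y \<union> Z. (if y \<in> Y then a y * G y else 0)) + (\<Sum>y\<in>Y \<union> Z. (if y \<in> Z then d y * G y else 0))"
        unfolding sum.distrib[symmetric] by (intro sum.cong) (auto simp: e_def algebra_simps)
      then show ?thesis
        using Y(1) Z(1) by (simp add: sum.inter_restrict[symmetric] Int_absorb1)
    qed
    have "(\<lambda>x. f x + g x) = kc (Y \<union> Z) e"
      by (simp add: Y(2) Z(2) kc_def split)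
    moreover have "b + c = (\<Sum>y\<in>Y \<union> Z. e y * cnj (F y))"
      by (simp add: Y(3) Z(3) split)
    moreover have "finite (Y \<union> Z)" using Y(1) Z(1) by simp
    ultimately show ?thesis unfolding R_def by blast
  qed
  have R_scale: "(\<lambda>x. s * g x, s * c) \<in> R" if gc: "(g, c) \<in> R" for g c s
  proof -
    obtain Y a where Y: "finite Y" "g = kc Y a" "c = (\<Sum>y\<in>Y. a y * cnj (F y))"
      using gc by (auto simp: R_def)
    have "(\<lambda>x. s * g x) = kc Y (\<lambda>y. s * a y)" "s * c = (\<Sum>y\<in>Y. (s * a y) * cnj (F y))"
      by (simp_all add: Y kc_def sum_distrib_left mult.assoc)
    then show ?thesis using Y(1) unfolding R_def by blast
  qed
  have R_bound: "cmod c \<le> C * nrm g" if gc: "(g, c) \<in> R" for g c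
  proof -
    obtain Y a where Y: "finite Y" "g = kc Y a" "c = (\<Sum>y\<in>Y. a y * cnj (F y))"
      using gc by (auto simp: R_def)
    have "cmod c = cmod (cnj c)" by simp
    also have "cnj c = (\<Sum>y\<in>Y. cnj (a y) * F y)" by (simp add: Y(3))
    finally show ?thesis using bound[OF Y(1)] Y(2) by simp
  qed
  have "(kc {} (\<lambda>_. 0), \<Sum>y\<in>{}. 0 * cnj (F y)) \<in> R" unfolding R_def by blast
  then have R_zero: "(\<lambda>x. 0, 0) \<in> R" by (simp add: kc_def)
  have R_mem: "g \<in> H" if "(g, c) \<in> R" for g c
    using that by (auto simp: R_def kc_mem)
  have "\<exists>G\<in>H. (\<forall>g c. (g, c) \<in> R \<longrightarrow> ip g G = c) \<and>
    (\<forall>e>0. \<exists>g c. (g, c) \<in> R \<and> nrm (\<lambda>x. G x - g x) < e)"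
    using R_mem R_zero R_add R_scale R_bound by (rule Riesz)
  then obtain G where G: "G \<in> H" and ipG: "\<And>g c. (g, c) \<in> R \<Longrightarrow> ip g G = c"
    and approx: "\<And>e. 0 < e \<Longrightarrow> \<exists>g c. (g, c) \<in> R \<and> nrm (\<lambda>x. G x - g x) < e"
    by blast
  have "G = F"
  proof (rule ext)
    fix w
    have "(kc {w} (\<lambda>_. 1), \<Sum>y\<in>{w}. 1 * cnj (F y)) \<in> R" unfolding R_def by blast
    then have "ip (\<lambda>z. k z w) G = cnj (F w)" using ipG by (simp add: kc_def)
    then show "G w = F w" using ip_cnj[OF kernel_mem G] reproducing[OF G] by simp
  qed
  then show "F \<in> H" using G by simp
  show "\<exists>Y a. finite Y \<and> nrm (\<lambda>x. F x - kc Y a x) < e" if "0 < e"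
    using approx[OF that] \<open>G = F\<close> unfolding R_def by blast
qed

text \<open>Cauchy-Schwarz supplies the bound of \<open>kernel_Riesz_approx\<close> with the
  constant \<open>nrm F\<close>.\<close>

lemma kc_dense:
  assumes F: "F \<in> H" and "0 < e"
  shows "\<exists>Y a. finite Y \<and> nrm (\<lambda>x. F x - kc Y a x) < e"
  using Cauchy_Schwarz[OF F kc_mem]
  by (intro kernel_Riesz_approx[of F "nrm F"]) (simp_all add: ip_kc F \<open>0 < e\<close>)

lemma kc_approx_seq:
  assumes F: "F \<in> H"
  shows "\<exists>Y a. (\<forall>n. finite (Y n)) \<and> (\<lambda>n. nrm (\<lambda>x. F x - kc (Y n) (a n) x)) \<longlonglongrightarrow> 0"
proof -
  have "\<forall>n::nat. \<exists>Y a. finite Y \<and> nrm (\<lambda>x. F x - kc Y a x) < inverse (Suc n)"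
    using kc_dense[OF F] by simp
  then obtain Y a where Y: "\<And>n. finite (Y n)"
    and lt: "\<And>n::nat. nrm (\<lambda>x. F x - kc (Y n) (a n) x) < inverse (Suc n)"
    by metis
  have "(\<lambda>n. nrm (\<lambda>x. F x - kc (Y n) (a n) x)) \<longlonglongrightarrow> 0"
  proof (rule Lim_null_comparison[OF _ LIMSEQ_inverse_real_of_nat], intro always_eventually allI)
    fix n
    show "norm (nrm (\<lambda>x. F x - kc (Y n) (a n) x)) \<le> inverse (real (Suc n))"
      using lt[of n] nrm_nonneg[OF diff_mem[OF F kc_mem]] by simp
  qed
  with Y show ?thesis by blast
qed

text \<open>For \<open>x\<close> in the span the bound gives
  \<open>2 * Re (ip F x) \<le> C\<^sup>2 + (nrm x)\<^sup>2\<close>, so the squared norm of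
  \<open>F\<close> exceeds that of \<open>F - x\<close> by at most \<open>C\<^sup>2\<close>. Then
  \<open>x\<close> tends to \<open>F\<close>.\<close>

lemma kernel_Riesz_norm:
  assumes "0 \<le> C"
    and bound: "\<And>Y a. finite Y \<Longrightarrow> cmod (\<Sum>y\<in>Y. cnj (a y) * F y) \<le> C * nrm (kc Y a)"
  shows "F \<in> H" "nrm F \<le> C"
proof -
  show F: "F \<in> H" by (rule kernel_Riesz_mem[OF bound])
  obtain Y a where Y: "\<And>n. finite (Y n)"
    and lim: "(\<lambda>n. nrm (\<lambda>x. F x - kc (Y n) (a n) x)) \<longlonglongrightarrow> 0"
    using kc_approx_seq[OF F] by blast
  have le: "2 * Re (ip F x) \<le> C\<^sup>2 + (nrm x)\<^sup>2" if "x = kc (Y n) (a n)" for n x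
  proof -
    have "Re (ip F x) \<le> C * nrm x"
      using bound[OF Y[of n], of "a n"] complex_Re_le_cmod[of "ip F x"] by (simp add: ip_kc F that)
    moreover have "0 \<le> (C - nrm x)\<^sup>2" by simp
    ultimately show ?thesis by (simp add: power2_diff)
  qed
  have le': "(nrm F)\<^sup>2 - (nrm (\<lambda>x. F x - kc (Y n) (a n) x))\<^sup>2 \<le> C\<^sup>2" for n
    using nrm_sq_diff[OF F kc_mem[of "Y n" "a n"]] le[OF refl, of n] by linarith
  have "(\<lambda>n. (nrm F)\<^sup>2 - (nrm (\<lambda>x. F x - kc (Y n) (a n) x))\<^sup>2) \<longlonglongrightarrow> (nrm F)\<^sup>2 - 0\<^sup>2"
    by (intro tendsto_intros lim)
  then have "(nrm F)\<^sup>2 - 0\<^sup>2 \<le> C\<^sup>2"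
    by (rule LIMSEQ_le_const2) (use le' in blast)
  then show "nrm F \<le> C" using \<open>0 \<le> C\<close> by (simp add: power2_le_imp_le[of "nrm F" C])
qed

end

section \<open>Positive semidefinite matrices\<close>

text \<open>Indexing by a set instead of by sequences with repetitions permits induction on the set.
  Membership in the nonnegative reals includes reality of the form, from which the hermitian
  symmetry follows.\<close>

definition psd_on :: "'a set \<Rightarrow> ('a \<Rightarrow> 'a \<Rightarrow> complex) \<Rightarrow> bool"
  where "psd_on Y A \<longleftrightarrow> (\<forall>a. (\<Sum>x\<in>Y. \<Sum>y\<in>Y. a x * cnj (a y) * A x y) \<in> \<real>\<^sub>\<ge>\<^sub>0)"

lemma psd_onD: "psd_on Y A \<Longrightarrow> (\<Sum>x\<in>Y. \<Sum>y\<in>Y. a x * cnj (a y) * A x y) \<in> \<real>\<^sub>\<ge>\<^sub>0"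
  by (simp add: psd_on_def)

lemma psd_on_subset:
  assumes "psd_on Y A" "finite Y" "Z \<subseteq> Y"
  shows "psd_on Z A"
  unfolding psd_on_def
proof
  fix a :: "_ \<Rightarrow> complex"
  define b where "b x = (if x \<in> Z then a x else (0::complex))" for x
  have restrict: "(\<Sum>x\<in>Y. if x \<in> Z then g x else 0) = (\<Sum>x\<in>Z. g x)" for g :: "_ \<Rightarrow> complex"
    using assms(2,3) by (simp add: sum.inter_restrict[symmetric] Int_absorb1)
  have "(\<Sum>y\<in>Y. b x * cnj (b y) * A x y) = (if x \<in> Z then \<Sum>y\<in>Z. a x * cnj (a y) * A x y else 0)" for x
    unfolding restrict[symmetric] by (auto simp: b_def intro!: sum.cong sum.neutral)
  then have "(\<Sum>x\<in>Y. \<Sum>y\<in>Y. b x * cnj (b y) * A x y) = (\<Sum>x\<in>Z. \<Sum>y\<in>Z. a x * cnj (a y) * A x y)"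
    by (simp add: restrict)
  then show "(\<Sum>x\<in>Z. \<Sum>y\<in>Z. a x * cnj (a y) * A x y) \<in> \<real>\<^sub>\<ge>\<^sub>0"
    using psd_onD[OF assms(1), of b] by simp
qed

lemma psd_on_diag:
  assumes "psd_on Y A" "finite Y" "p \<in> Y"
  shows "A p p \<in> \<real>\<^sub>\<ge>\<^sub>0"
proof -
  have "psd_on {p} A" using psd_on_subset[OF assms(1,2), of "{p}"] assms(3) by simp
  from psd_onD[OF this, of "\<lambda>_. 1"] show ?thesis by simp
qed

lemma psd_on_pair:
  assumes "psd_on Y A" "finite Y" "p \<in> Y" "q \<in> Y" "p \<noteq> q"
  shows "A p p + cnj c * A p q + c * A q p + c * cnj c * A q q \<in> \<real>\<^sub>\<ge>\<^sub>0"
proof -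
  have "psd_on {p, q} A" using psd_on_subset[OF assms(1,2), of "{p, q}"] assms(3,4) by simp
  define a where "a x = (if x = p then 1 else c)" for x
  have "(\<Sum>x\<in>{p, q}. \<Sum>y\<in>{p, q}. a x * cnj (a y) * A x y) \<in> \<real>\<^sub>\<ge>\<^sub>0"
    using \<open>psd_on {p, q} A\<close> by (rule psd_onD)
  then show ?thesis using assms(5) by (simp add: a_def add_ac)
qed

lemma psd_on_cnj:
  assumes "psd_on Y A" "finite Y" "p \<in> Y" "q \<in> Y"
  shows "A q p = cnj (A p q)"
proof (cases "p = q")
  case True
  then show ?thesis
    using psd_on_diag[OF assms(1,2,3)] by (auto simp: nonneg_Reals_def)
next
  case False
  have diag: "Im (A p p) = 0" "Im (A q q) = 0"
    using psd_on_diag[OF assms(1,2)] assms(3,4) by (auto simp: complex_nonneg_Reals_iff)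
  \<comment> \<open>The coefficients \<open>c = 1\<close> and \<open>c = \<i>\<close> compare the
    imaginary and the real parts of the two off-diagonal entries.\<close>
  have "Im (A p q) + Im (A q p) = 0"
    using psd_on_pair[OF assms(1-4) False, of 1] diag by (simp add: complex_nonneg_Reals_iff)
  moreover have "Re (A q p) - Re (A p q) = 0"
    using psd_on_pair[OF assms(1-4) False, of \<i>] diag by (simp add: complex_nonneg_Reals_iff)
  ultimately show ?thesis by (simp add: complex_eq_iff)
qed

lemma psd_on_diag_0:
  assumes "psd_on Y A" "finite Y" "p \<in> Y" "q \<in> Y" "A q q = 0"
  shows "A p q = 0"
proof (rule ccontr)
  assume nz: "A p q \<noteq> 0"
  then have "p \<noteq> q" using assms(5) by auto
  \<comment> \<open>Because \<open>A q q = 0\<close>, the form at the coefficients 1 and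
    \<open>- t * A p q\<close> is affine in \<open>t\<close>; this \<open>t\<close> brings it down
    to \<open>- Re (A p p) - 2\<close>.\<close>
  define t where "t = (Re (A p p) + 1) / (cmod (A p q))\<^sup>2"
  have "0 \<le> Re (A p p + cnj (- of_real t * A p q) * A p q + (- of_real t * A p q) * A q p)"
    using psd_on_pair[OF assms(1-4) \<open>p \<noteq> q\<close>, of "- of_real t * A p q"] assms(5)
    by (simp add: complex_nonneg_Reals_iff)
  also have "\<dots> = Re (A p p) - 2 * (t * (cmod (A p q))\<^sup>2)"
    using psd_on_cnj[OF assms(1-4)]
    unfolding cmod_power2 by (simp add: power2_eq_square algebra_simps)
  also have "t * (cmod (A p q))\<^sup>2 = Re (A p p) + 1"
    using nz by (simp add: t_def)
  finally have "Re (A p p) + 2 \<le> 0" by simp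
  then show False
    using psd_on_diag[OF assms(1-3)] by (simp add: complex_nonneg_Reals_iff)
qed

text \<open>Cholesky factorization by induction: splitting off the column of \<open>p\<close> leaves
  a Schur complement that is again positive semidefinite.\<close>

lemma psd_on_factorization:
  assumes "finite Y" "psd_on Y A"
  shows "\<exists>b. \<forall>x\<in>Y. \<forall>y\<in>Y. A x y = (\<Sum>l\<in>Y. b x l * cnj (b y l))"
  using assms
proof (induction Y arbitrary: A rule: finite_induct)
  case empty
  then show ?case by simp
next
  case (insert p Y)
  let ?I = "insert p Y"
  note psd = insert.prems
  have fin: "finite ?I" using insert.hyps by simp
  define r where "r = Re (A p p)"
  have d: "A p p = of_real r" and r0: "0 \<le> r"
    using psd_on_diag[OF psd fin, of p] by (auto simp: r_def complex_nonneg_Reals_iff complex_eq_iff)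
  have herm: "A p x = cnj (A x p)" if "x \<in> ?I" for x
    using psd_on_cnj[OF psd fin that, of p] by simp
  have zero: "A x p = 0" if "x \<in> ?I" "r = 0" for x
    using psd_on_diag_0[OF psd fin that(1), of p] that(2) d by simp
  \<comment> \<open>This is the Schur complement. If \<open>r = 0\<close>, the column of
    \<open>p\<close> vanishes by \<open>zero\<close>, and division by 0 yields the correct
    correction 0.\<close>
  define A' where "A' x y = A x y - A x p * A p y / of_real r" for x y
  have "psd_on Y A'"
    unfolding psd_on_def
  proof
    fix a
    define B where "B = (\<Sum>x\<in>Y. a x * A x p)"
    \<comment> \<open>This coordinate at \<open>p\<close> completes the square, so the form of
      \<open>A\<close> at \<open>a'\<close> equals the form of \<open>A'\<close> at
      \<open>a\<close>.\<close>
    define c where "c = - B / of_real r"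
    define a' where "a' = a(p := c)"
    have cB: "(\<Sum>y\<in>Y. cnj (a y) * A p y) = cnj B"
      unfolding B_def cnj_sum by (intro sum.cong) (auto simp: herm)
    have a'Y: "(\<Sum>x\<in>Y. g x (a' x)) = (\<Sum>x\<in>Y. g x (a x))" for g :: "_ \<Rightarrow> complex \<Rightarrow> complex"
      using insert.hyps(2) by (intro sum.cong) (auto simp: a'_def)
    have B0: "B = 0" if "r = 0"
      using zero[OF _ that] by (simp add: B_def)
    have "(\<Sum>x\<in>?I. \<Sum>y\<in>?I. a' x * cnj (a' y) * A x y)
      = c * cnj c * A p p + (\<Sum>y\<in>Y. c * cnj (a' y) * A p y)
        + (\<Sum>x\<in>Y. a' x * cnj c * A x p + (\<Sum>y\<in>Y. a' x * cnj (a' y) * A x y))"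
      using insert.hyps by (simp add: a'_def)
    also have "\<dots> = c * cnj c * A p p + (\<Sum>y\<in>Y. c * cnj (a y) * A p y)
        + (\<Sum>x\<in>Y. a x * cnj c * A x p + (\<Sum>y\<in>Y. a x * cnj (a y) * A x y))"
      unfolding a'Y[of "\<lambda>y b. c * cnj b * A p y"]
        a'Y[of "\<lambda>y b. a' x * cnj b * A x y" for x]
        a'Y[of "\<lambda>x b. b * cnj c * A x p + (\<Sum>y\<in>Y. b * cnj (a y) * A x y)"] ..
    also have "\<dots> = c * cnj c * A p p + c * cnj B + cnj c * B + (\<Sum>x\<in>Y. \<Sum>y\<in>Y. a x * cnj (a y) * A x y)"
    proof -
      have "(\<Sum>y\<in>Y. c * cnj (a y) * A p y) = c * cnj B"
        by (simp add: cB[symmetric] sum_distrib_left mult.assoc)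
      moreover have "(\<Sum>x\<in>Y. a x * cnj c * A x p) = cnj c * B"
        by (simp add: B_def sum_distrib_left mult_ac)
      ultimately show ?thesis by (simp add: sum.distrib)
    qed
    also have "c * cnj c * A p p + c * cnj B + cnj c * B = - (B * cnj B / of_real r)"
      using B0 by (cases "r = 0") (simp_all add: c_def d)
    also have "- (B * cnj B / of_real r) + (\<Sum>x\<in>Y. \<Sum>y\<in>Y. a x * cnj (a y) * A x y)
      = (\<Sum>x\<in>Y. \<Sum>y\<in>Y. a x * cnj (a y) * A' x y)"
    proof -
      have "B * cnj B / of_real r = (\<Sum>x\<in>Y. \<Sum>y\<in>Y. a x * cnj (a y) * (A x p * A p y / of_real r))"
        unfolding cB[symmetric] by (simp add: B_def sum_product sum_divide_distrib mult_ac)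
      then show ?thesis by (simp add: A'_def right_diff_distrib sum_subtractf)
    qed
    finally show "(\<Sum>x\<in>Y. \<Sum>y\<in>Y. a x * cnj (a y) * A' x y) \<in> \<real>\<^sub>\<ge>\<^sub>0"
      using psd_onD[OF psd, of a'] by simp
  qed
  then obtain b' where b': "\<And>x y. x \<in> Y \<Longrightarrow> y \<in> Y \<Longrightarrow> A' x y = (\<Sum>l\<in>Y. b' x l * cnj (b' y l))"
    using insert.IH by blast
  \<comment> \<open>Column \<open>p\<close> carries the rank-one part that was split off; the other
    columns factor \<open>A'\<close> and are 0 in row \<open>p\<close>.\<close>
  define b where "b x l = (if l = p then A x p / of_real (sqrt r) else if x = p then 0 else b' x l)" for x l
  have sq: "of_real (sqrt r) * of_real (sqrt r) = (of_real r :: complex)"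
    using r0 by (simp flip: of_real_mult)
  have "A x y = (\<Sum>l\<in>?I. b x l * cnj (b y l))" if xy: "x \<in> ?I" "y \<in> ?I" for x y
  proof -
    have rest: "(\<Sum>l\<in>Y. b x l * cnj (b y l)) = (if x = p \<or> y = p then 0 else A' x y)"
    proof -
      have "(\<Sum>l\<in>Y. b x l * cnj (b y l))
        = (\<Sum>l\<in>Y. if x = p \<or> y = p then 0 else b' x l * cnj (b' y l))"
        using insert.hyps(2) by (intro sum.cong) (auto simp: b_def)
      then show ?thesis using b' xy by auto
    qed
    have "(\<Sum>l\<in>?I. b x l * cnj (b y l)) = b x p * cnj (b y p) + (\<Sum>l\<in>Y. b x l * cnj (b y l))"
      using insert.hyps by simp
    also have "b x p * cnj (b y p) = A x p * A p y / of_real r"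
      by (simp add: b_def sq flip: herm[OF xy(2)])
    also have "A x p * A p y / of_real r + (\<Sum>l\<in>Y. b x l * cnj (b y l)) = A x y"
      using zero[OF xy(1)] zero[OF xy(2)] herm[OF xy(2)] d unfolding rest
      by (cases "r = 0"; cases "x = p"; cases "y = p") (simp_all add: A'_def)
    finally show ?thesis ..
  qed
  then show ?case by blast
qed

lemma positive_definite_psd_on:
  assumes u: "positive_definite u" and Y: "finite Y"
  shows "psd_on Y u"
  unfolding psd_on_def
proof
  fix a :: "_ \<Rightarrow> complex"
  obtain z where z: "bij_betw z {..<card Y} Y"
    using ex_bij_betw_nat_finite[OF Y] by (auto simp: atLeast0LessThan)
  have "(\<Sum>i<card Y. \<Sum>j<card Y. a (z i) * cnj (a (z j)) * u (z i) (z j)) \<in> \<real>\<^sub>\<ge>\<^sub>0"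
    using u[unfolded positive_definite_def, rule_format, of "\<lambda>i. a (z i)" z "card Y"] .
  also have "(\<Sum>i<card Y. \<Sum>j<card Y. a (z i) * cnj (a (z j)) * u (z i) (z j))
    = (\<Sum>i<card Y. \<Sum>y\<in>Y. a (z i) * cnj (a y) * u (z i) y)"
    by (intro sum.cong refl sum.reindex_bij_betw[OF z, of "\<lambda>y. a (z i) * cnj (a y) * u (z i) y" for i])
  also have "\<dots> = (\<Sum>x\<in>Y. \<Sum>y\<in>Y. a x * cnj (a y) * u x y)"
    by (rule sum.reindex_bij_betw[OF z])
  finally show "(\<Sum>x\<in>Y. \<Sum>y\<in>Y. a x * cnj (a y) * u x y) \<in> \<real>\<^sub>\<ge>\<^sub>0" .
qed

section \<open>Complete Pick kernels\<close>

context hilbert_function_space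
begin

lemma ip_sum_sum:
  assumes "\<And>v. v \<in> V \<Longrightarrow> h v \<in> H" "\<And>w. w \<in> W \<Longrightarrow> g w \<in> H"
  shows "ip (\<lambda>z. \<Sum>v\<in>V. c v * h v z) (\<lambda>z. \<Sum>w\<in>W. d w * g w z)
    = (\<Sum>v\<in>V. \<Sum>w\<in>W. c v * cnj (d w) * ip (h v) (g w))"
proof -
  have W: "(\<lambda>z. \<Sum>w\<in>W. d w * g w z) \<in> H"
    using assms(2) by (intro sum_mem scale_mem)
  have "ip (\<lambda>z. \<Sum>v\<in>V. c v * h v z) (\<lambda>z. \<Sum>w\<in>W. d w * g w z)
    = (\<Sum>v\<in>V. ip (\<lambda>z. c v * h v z) (\<lambda>z. \<Sum>w\<in>W. d w * g w z))"
    using assms(1) W by (intro ip_sum scale_mem)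
  also have "\<dots> = (\<Sum>v\<in>V. c v * (\<Sum>w\<in>W. cnj (d w) * ip (h v) (g w)))"
    by (intro sum.cong refl) (simp add: ip_scale ip_sum_right ip_scale_right assms W scale_mem)
  finally show ?thesis by (simp add: sum_distrib_left mult.assoc)
qed

text \<open>This is Schur's product theorem in explicit form: a factorization of one matrix writes
  its entrywise product with a Gram matrix as a sum of squares. The order of the indices is the one
  for which kernels \<open>h v\<close> give \<open>ip (h v) (h w) = k w v\<close>.\<close>

lemma sum_nrm_sq:
  assumes h: "\<And>v. v \<in> V \<Longrightarrow> h v \<in> H"
    and A: "\<And>v w. v \<in> V \<Longrightarrow> w \<in> V \<Longrightarrow> A w v = (\<Sum>l\<in>L. b w l * cnj (b v l))"
  shows "(\<Sum>l\<in>L. (nrm (\<lambda>z. \<Sum>v\<in>V. cnj (b v l) * h v z))\<^sup>2)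
    = Re (\<Sum>v\<in>V. \<Sum>w\<in>V. A w v * ip (h v) (h w))"
proof -
  have "(\<Sum>v\<in>V. \<Sum>w\<in>V. A w v * ip (h v) (h w))
    = (\<Sum>v\<in>V. \<Sum>w\<in>V. \<Sum>l\<in>L. cnj (b v l) * cnj (cnj (b w l)) * ip (h v) (h w))"
    by (intro sum.cong refl) (simp add: A sum_distrib_left mult_ac)
  also have "\<dots> = (\<Sum>v\<in>V. \<Sum>l\<in>L. \<Sum>w\<in>V. cnj (b v l) * cnj (cnj (b w l)) * ip (h v) (h w))"
    by (intro sum.cong refl sum.swap)
  also have "\<dots> = (\<Sum>l\<in>L. \<Sum>v\<in>V. \<Sum>w\<in>V. cnj (b v l) * cnj (cnj (b w l)) * ip (h v) (h w))"
    by (rule sum.swap)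
  also have "\<dots> = (\<Sum>l\<in>L. ip (\<lambda>z. \<Sum>v\<in>V. cnj (b v l) * h v z) (\<lambda>z. \<Sum>v\<in>V. cnj (b v l) * h v z))"
    by (simp only: ip_sum_sum h)
  also have "Re \<dots> = (\<Sum>l\<in>L. (nrm (\<lambda>z. \<Sum>v\<in>V. cnj (b v l) * h v z))\<^sup>2)"
    unfolding Re_sum using h by (intro sum.cong refl nrm_sq[symmetric] sum_mem scale_mem)
  finally show ?thesis ..
qed

end

locale complete_Pick_space = kernel_space H ip k
  for H :: "('x \<Rightarrow> complex) set" and ip k +
  fixes u :: "'x \<Rightarrow> 'x \<Rightarrow> complex" and z0 :: 'x
  assumes kernel_z0: "k z z0 = 1"
    and pd: "positive_definite u"
    and u_neq_1: "u z w \<noteq> 1"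
    and kernel_eq: "k z w = 1 / (1 - u z w)"
begin

lemma one_mem: "(\<lambda>_. 1) \<in> H"
  using kernel_mem[of z0] by (simp add: kernel_z0)

lemma kernel_u: "u z w * k z w = k z w - 1" "k z w * u z w = k z w - 1"
  using u_neq_1[of z w] by (auto simp: kernel_eq field_simps)

lemma kernel_nz: "k z w \<noteq> 0"
  using u_neq_1[of z w] by (simp add: kernel_eq)

text \<open>
  Writing \<open>u z w = (\<Sum>l. b z l * cnj (b w l))\<close>, this says that multiplication by the row
  \<open>b\<close> is a contraction.
\<close>

lemma row_contraction:
  assumes V: "finite V" and h: "\<And>v. v \<in> V \<Longrightarrow> h v \<in> H"
  defines "F \<equiv> \<lambda>z. \<Sum>v\<in>V. u z v * h v z"
    and "A \<equiv> Re (\<Sum>v\<in>V. \<Sum>w\<in>V. u w v * ip (h v) (h w))"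
  shows "F \<in> H" "(nrm F)\<^sup>2 \<le> A"
proof -
  have *: "0 \<le> A \<and> cmod (\<Sum>y\<in>Y. cnj (a y) * F y) \<le> sqrt A * nrm (kc Y a)" if Y: "finite Y" for Y a
  proof -
    \<comment> \<open>One factorization of \<open>u\<close> over the union serves both the input
      \<open>h\<close> and the test combination \<open>kc Y a\<close>.\<close>
    let ?Z = "V \<union> Y"
    have Z: "finite ?Z" using V Y by simp
    obtain b where b: "\<And>x y. x \<in> ?Z \<Longrightarrow> y \<in> ?Z \<Longrightarrow> u x y = (\<Sum>l\<in>?Z. b x l * cnj (b y l))"
      using psd_on_factorization[OF Z positive_definite_psd_on[OF pd Z]] by blast
    define X where "X l = (\<lambda>z. \<Sum>v\<in>V. cnj (b v l) * h v z)" for l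
    define W where "W l = kc Y (\<lambda>y. cnj (b y l) * a y)" for l
    have X: "X l \<in> H" for l unfolding X_def using h by (intro sum_mem scale_mem)
    have W: "W l \<in> H" for l unfolding W_def by (rule kc_mem)
    have sumX: "(\<Sum>l\<in>?Z. (nrm (X l))\<^sup>2) = A"
      unfolding X_def A_def using h b by (intro sum_nrm_sq) auto
    have W_eq: "W l = (\<lambda>z. \<Sum>y\<in>Y. cnj (b y l) * (a y * k z y))" for l
      by (simp add: W_def kc_def mult.assoc)
    \<comment> \<open>The \<open>W l\<close> form the adjoint of the row applied to
      \<open>kc Y a\<close>. Because \<open>u * k = k - 1\<close>, their squared norms sum to that
      of \<open>kc Y a\<close> minus the squared modulus of the sum of the coefficients.\<close>
    have "(\<Sum>l\<in>?Z. (nrm (W l))\<^sup>2)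
      = Re (\<Sum>v\<in>Y. \<Sum>w\<in>Y. u w v * ip (\<lambda>z. a v * k z v) (\<lambda>z. a w * k z w))"
      unfolding W_eq by (intro sum_nrm_sq scale_mem kernel_mem b) auto
    also have "(\<Sum>v\<in>Y. \<Sum>w\<in>Y. u w v * ip (\<lambda>z. a v * k z v) (\<lambda>z. a w * k z w))
      = (\<Sum>v\<in>Y. \<Sum>w\<in>Y. a v * cnj (a w) * ip (\<lambda>z. k z v) (\<lambda>z. k z w) - a v * cnj (a w))"
    proof (intro sum.cong refl)
      fix v w
      have "u w v * ip (\<lambda>z. a v * k z v) (\<lambda>z. a w * k z w) = a v * cnj (a w) * (u w v * k w v)"
        by (simp add: ip_scale ip_scale_right kernel_mem scale_mem reproducing)
      then show "u w v * ip (\<lambda>z. a v * k z v) (\<lambda>z. a w * k z w)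
        = a v * cnj (a w) * ip (\<lambda>z. k z v) (\<lambda>z. k z w) - a v * cnj (a w)"
        by (simp add: kernel_u kernel_mem reproducing right_diff_distrib)
    qed
    also have "\<dots> = ip (kc Y a) (kc Y a) - (\<Sum>y\<in>Y. a y) * cnj (\<Sum>y\<in>Y. a y)"
      by (simp add: kc_def ip_sum_sum kernel_mem sum_subtractf sum_product)
    also have "Re \<dots> = (nrm (kc Y a))\<^sup>2 - (cmod (\<Sum>y\<in>Y. a y))\<^sup>2"
      by (simp add: nrm_sq kc_mem flip: complex_norm_square del: cnj_sum)
    finally have sumW: "(\<Sum>l\<in>?Z. (nrm (W l))\<^sup>2) \<le> (nrm (kc Y a))\<^sup>2" by simp
    \<comment> \<open>The pairing splits over \<open>l\<close> into inner products of
      \<open>X l\<close> and \<open>W l\<close>. Cauchy-Schwarz is then used twice, in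
      \<open>H\<close> and in the sum over \<open>l\<close>.\<close>
    have "(\<Sum>y\<in>Y. cnj (a y) * F y) = (\<Sum>y\<in>Y. \<Sum>v\<in>V. \<Sum>l\<in>?Z. cnj (a y) * (b y l * (cnj (b v l) * h v y)))"
      unfolding F_def sum_distrib_left
      by (intro sum.cong refl) (simp add: b sum_distrib_right sum_distrib_left mult_ac)
    also have "\<dots> = (\<Sum>y\<in>Y. \<Sum>l\<in>?Z. \<Sum>v\<in>V. cnj (a y) * (b y l * (cnj (b v l) * h v y)))"
      by (intro sum.cong refl sum.swap)
    also have "\<dots> = (\<Sum>l\<in>?Z. \<Sum>y\<in>Y. \<Sum>v\<in>V. cnj (a y) * (b y l * (cnj (b v l) * h v y)))"
      by (rule sum.swap)
    also have "\<dots> = (\<Sum>l\<in>?Z. ip (X l) (W l))"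
      unfolding W_def ip_kc[OF X] by (simp add: X_def sum_distrib_left mult_ac)
    also have "cmod \<dots> \<le> (\<Sum>l\<in>?Z. \<bar>nrm (X l)\<bar> * \<bar>nrm (W l)\<bar>)"
      by (intro sum_norm_le order_trans[OF Cauchy_Schwarz] X W) (simp add: nrm_nonneg X W)
    also have "\<dots> \<le> L2_set (\<lambda>l. nrm (X l)) ?Z * L2_set (\<lambda>l. nrm (W l)) ?Z"
      by (rule L2_set_mult_ineq)
    also have "\<dots> \<le> sqrt A * nrm (kc Y a)"
      unfolding L2_set_def sumX
      using sumW sum_nonneg[of ?Z "\<lambda>l. (nrm (X l))\<^sup>2"] unfolding sumX
      by (intro mult_left_mono real_le_lsqrt) (auto simp: sum_nonneg nrm_nonneg kc_mem)
    finally show ?thesis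
      using sum_nonneg[of ?Z "\<lambda>l. (nrm (X l))\<^sup>2"] unfolding sumX by simp
  qed
  have A: "0 \<le> A" using *[of "{}"] by simp
  then have C: "0 \<le> sqrt A" by simp
  show F: "F \<in> H" using kernel_Riesz_norm(1)[OF C, of F] * by blast
  have "nrm F \<le> sqrt A" using kernel_Riesz_norm(2)[OF C, of F] * by blast
  then have "(nrm F)\<^sup>2 \<le> (sqrt A)\<^sup>2" using nrm_nonneg[OF F] by (rule power_mono)
  then show "(nrm F)\<^sup>2 \<le> A" using A by simp
qed

text \<open>As \<open>k v v\<close> is a squared norm, \<open>1 / (1 - u v v)\<close> is
  nonnegative. The strict bound makes multiplication by \<open>u\<^sub>v\<close> strictly
  contractive.\<close>

lemma u_diag: "0 \<le> Re (u v v)" "Re (u v v) < 1"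
proof -
  have u: "u v v \<in> \<real>\<^sub>\<ge>\<^sub>0"
    using psd_on_diag[OF positive_definite_psd_on[OF pd, of "{v}"], of v] by simp
  then obtain r where r: "u v v = of_real r" "0 \<le> r" by (auto simp: nonneg_Reals_def)
  have "0 \<le> Re (k v v)"
    using Re_ip_self_nonneg[OF kernel_mem[of v]] by (simp add: reproducing kernel_mem)
  moreover have "k v v = of_real (1 / (1 - r))" by (simp add: kernel_eq r)
  ultimately have "0 \<le> 1 / (1 - r)" by (simp only: Re_complex_of_real)
  moreover have "r \<noteq> 1" using u_neq_1[of v v] r by auto
  ultimately show "0 \<le> Re (u v v)" "Re (u v v) < 1" using r by auto
qed

lemma u_multiplier:
  assumes h: "h \<in> H"
  shows "(\<lambda>z. u z v * h z) \<in> H" "nrm (\<lambda>z. u z v * h z) \<le> sqrt (Re (u v v)) * nrm h"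
proof -
  show m: "(\<lambda>z. u z v * h z) \<in> H"
    using row_contraction(1)[of "{v}" "\<lambda>_. h"] h by simp
  have "(nrm (\<lambda>z. u z v * h z))\<^sup>2 \<le> Re (u v v * ip h h)"
    using row_contraction(2)[of "{v}" "\<lambda>_. h"] h by simp
  also have "\<dots> = (sqrt (Re (u v v)) * nrm h)\<^sup>2"
    using u_diag[of v] by (simp add: ip_self h power_mult_distrib)
  finally show "nrm (\<lambda>z. u z v * h z) \<le> sqrt (Re (u v v)) * nrm h"
    by (rule power2_le_imp_le) (simp add: u_diag nrm_nonneg h)
qed

text \<open>
  Since \<open>k\<^sub>v = 1 / (1 - u\<^sub>v)\<close> and \<open>u\<^sub>v\<close> is a strictly contractive multiplier, the adjoint of
  \<open>1 - u\<^sub>v\<close> is bounded below on the span of the kernels.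
\<close>

lemma kernel_multiplier:
  obtains C where "0 \<le> C" "\<And>h. h \<in> H \<Longrightarrow> (\<lambda>z. k z v * h z) \<in> H"
    "\<And>h. h \<in> H \<Longrightarrow> nrm (\<lambda>z. k z v * h z) \<le> C * nrm h"
proof -
  define \<rho> where "\<rho> = sqrt (Re (u v v))"
  have \<rho>: "0 \<le> \<rho>" "\<rho> < 1" using u_diag[of v] by (auto simp: \<rho>_def)
  define C where "C = 1 / (1 - \<rho>)"
  have C: "0 \<le> C" using \<rho> by (simp add: C_def)
  have low: "nrm (kc Y (\<lambda>y. a y * cnj (k y v))) \<le> C * nrm (kc Y a)" for Y a
  proof -
    define \<alpha> where "\<alpha> y = a y * cnj (k y v)" for y
    \<comment> \<open>Here \<open>t\<close> is the formal adjoint of multiplication by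
      \<open>k\<^sub>v\<close> at \<open>kc Y a\<close>, and \<open>s\<close> is the adjoint of
      multiplication by \<open>u\<^sub>v\<close> at \<open>t\<close>. The identity
      \<open>k * (1 - u) = 1\<close> becomes \<open>t = kc Y a + s\<close>, where the norm of
      \<open>s\<close> is at most \<rho> times that of \<open>t\<close>.\<close>
    define t where "t = kc Y \<alpha>"
    define s where "s = kc Y (\<lambda>y. \<alpha> y * cnj (u y v))"
    have s: "s \<in> H" and t: "t \<in> H" by (simp_all add: s_def t_def kc_mem)
    have "(nrm s)\<^sup>2 = Re (ip (\<lambda>z. u z v * s z) t)"
    proof -
      have "ip s s = (\<Sum>y\<in>Y. cnj (\<alpha> y) * (u y v * s y))"
        using ip_kc[OF s, of Y "\<lambda>y. \<alpha> y * cnj (u y v)"] by (simp add: mult.assoc flip: s_def)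
      also have "\<dots> = ip (\<lambda>z. u z v * s z) t"
        unfolding t_def by (simp add: ip_kc u_multiplier s)
      finally show ?thesis by (simp add: nrm_sq s)
    qed
    also have "\<dots> \<le> nrm (\<lambda>z. u z v * s z) * nrm t"
      by (rule order_trans[OF complex_Re_le_cmod Cauchy_Schwarz[OF u_multiplier(1)[OF s] t]])
    also have "\<dots> \<le> \<rho> * nrm s * nrm t"
      unfolding \<rho>_def by (intro mult_right_mono u_multiplier s nrm_nonneg t)
    finally have "nrm s * nrm s \<le> nrm s * (\<rho> * nrm t)" by (simp add: power2_eq_square mult_ac)
    then have "nrm s \<le> \<rho> * nrm t"
      using nrm_nonneg[OF s] nrm_nonneg[OF t] \<rho> by (cases "nrm s = 0") auto
    moreover have "nrm t \<le> nrm (kc Y a) + nrm s"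
    proof -
      have "\<alpha> y * (1 - cnj (u y v)) = a y" for y
      proof -
        have "k y v * (1 - u y v) = 1" by (simp add: right_diff_distrib kernel_u)
        from arg_cong[OF this, of cnj] show ?thesis by (simp add: \<alpha>_def mult.assoc)
      qed
      then have "a y = \<alpha> y - \<alpha> y * cnj (u y v)" for y by (simp add: right_diff_distrib)
      then have "(\<lambda>z. kc Y a z + s z) = t"
        by (simp add: s_def t_def kc_def left_diff_distrib sum_subtractf)
      then show ?thesis using hnorm_triangle[OF kc_mem s, of Y a] by simp
    qed
    ultimately have "(1 - \<rho>) * nrm t \<le> nrm (kc Y a)" by (simp add: algebra_simps)
    then have "nrm t \<le> C * nrm (kc Y a)" using \<rho> by (simp add: C_def field_simps)
    then show ?thesis by (simp add: t_def \<alpha>_def[abs_def])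
  qed
  have bound: "cmod (\<Sum>y\<in>Y. cnj (a y) * (k y v * h y)) \<le> (C * nrm h) * nrm (kc Y a)" if h: "h \<in> H" for h Y a
  proof -
    have "(\<Sum>y\<in>Y. cnj (a y) * (k y v * h y)) = ip h (kc Y (\<lambda>y. a y * cnj (k y v)))"
      by (simp add: ip_kc h mult.assoc)
    also have "cmod \<dots> \<le> nrm h * nrm (kc Y (\<lambda>y. a y * cnj (k y v)))"
      by (rule Cauchy_Schwarz[OF h kc_mem])
    also have "\<dots> \<le> nrm h * (C * nrm (kc Y a))"
      by (intro mult_left_mono low nrm_nonneg h)
    finally show ?thesis by (simp add: mult_ac)
  qed
  show thesis
  proof (rule that[OF C])
    fix h assume h: "h \<in> H"
    have nn: "0 \<le> C * nrm h" using C nrm_nonneg[OF h] by simp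
    show "(\<lambda>z. k z v * h z) \<in> H" "nrm (\<lambda>z. k z v * h z) \<le> C * nrm h"
      using kernel_Riesz_norm[OF nn, of "\<lambda>z. k z v * h z"] bound[OF h] by blast+
  qed
qed

lemma kernel_mult_mem: "h \<in> H \<Longrightarrow> (\<lambda>z. k z v * h z) \<in> H"
  using kernel_multiplier by blast

lemma kc_mult_mem:
  assumes "h \<in> H"
  shows "(\<lambda>z. kc Y a z * h z) \<in> H"
proof -
  have "(\<lambda>z. kc Y a z * h z) = (\<lambda>z. \<Sum>y\<in>Y. a y * (k z y * h z))"
    by (simp add: kc_def sum_distrib_right mult.assoc)
  then show ?thesis using assms by (simp add: sum_mem scale_mem kernel_mult_mem)
qed

lemma kernel_psd_on: "psd_on Y k"
  unfolding psd_on_def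
proof
  fix a
  have "(\<Sum>x\<in>Y. \<Sum>y\<in>Y. a x * cnj (a y) * k x y) = (\<Sum>y\<in>Y. \<Sum>x\<in>Y. a x * cnj (a y) * k x y)"
    by (rule sum.swap)
  also have "\<dots> = ip (\<lambda>z. \<Sum>y\<in>Y. cnj (a y) * k z y) (\<lambda>z. \<Sum>y\<in>Y. cnj (a y) * k z y)"
    by (simp add: ip_sum_sum kernel_mem reproducing mult_ac)
  also have "\<dots> \<in> \<real>\<^sub>\<ge>\<^sub>0"
    by (intro ip_nonneg sum_mem scale_mem kernel_mem)
  finally show "(\<Sum>x\<in>Y. \<Sum>y\<in>Y. a x * cnj (a y) * k x y) \<in> \<real>\<^sub>\<ge>\<^sub>0" .
qed

text \<open>
  On the Hardy space this is the holomorphic function with real part \<open>\<bar>f\<bar>\<^sup>2\<close> and value \<open>\<parallel>f\<parallel>\<^sup>2\<close>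
  at \<open>0\<close>, and the inequality below is an equality.
\<close>

definition sarason :: "('x \<Rightarrow> complex) \<Rightarrow> 'x \<Rightarrow> complex"
  where "sarason f w = 2 * ip f (\<lambda>z. k z w * f z) - ip f f"

text \<open>Put \<open>p v = k\<^sub>v * f\<close>. Then \<open>p v - f = u\<^sub>v * p v\<close>,
  so the row contraction, combined with a factorization of \<open>k\<close>, bounds the form
  \<open>S E\<close> of these differences by \<open>S G\<close>. Expanding \<open>E\<close> turns
  this into a lower bound for \<open>S D\<close>, whose real part is the right-hand side.\<close>

lemma Re_sarason:
  assumes f: "f \<in> H" and Y: "finite Y"
  shows "(nrm (\<lambda>z. kc Y \<alpha> z * f z))\<^sup>2 \<le> Re (\<Sum>w\<in>Y. cnj (\<alpha> w) * sarason f w * kc Y \<alpha> w)"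
proof -
  define p where "p v = (\<lambda>z. k z v * f z)" for v
  have p: "p v \<in> H" for v unfolding p_def by (rule kernel_mult_mem[OF f])
  define S where "S g = (\<Sum>v\<in>Y. \<Sum>w\<in>Y. \<alpha> v * cnj (\<alpha> w) * g v w)" for g
  define E where "E v w = k w v * ip (\<lambda>z. p v z - f z) (\<lambda>z. p w z - f z)" for v w
  define G where "G v w = u w v * k w v * ip (p v) (p w)" for v w
  define D where "D v w = k w v * (ip (p v) f + ip f (p w) - ip f f)" for v w
  obtain b where b: "\<And>x y. x \<in> Y \<Longrightarrow> y \<in> Y \<Longrightarrow> k x y = (\<Sum>l\<in>Y. b x l * cnj (b y l))"
    using psd_on_factorization[OF Y kernel_psd_on] by blast
  \<comment> \<open>This is the row contraction for the functions
    \<open>\<alpha> v * cnj (b v l) * p v\<close>; summing over \<open>l\<close> restores the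
    weights \<open>k w v\<close>.\<close>
  have row: "(nrm (\<lambda>z. \<Sum>v\<in>Y. cnj (b v l) * (\<alpha> v * (p v z - f z))))\<^sup>2
      \<le> Re (\<Sum>v\<in>Y. \<Sum>w\<in>Y. u w v * (\<alpha> v * cnj (\<alpha> w) * (b w l * cnj (b v l)) * ip (p v) (p w)))" for l
  proof -
    have "u z v * p v z = p v z - f z" for v z
      using arg_cong[OF kernel_u(1)[of z v], of "\<lambda>c. c * f z"]
      by (simp add: p_def left_diff_distrib mult.assoc)
    then have eq1: "u z v * (\<alpha> v * cnj (b v l) * p v z) = cnj (b v l) * (\<alpha> v * (p v z - f z))" for v z
      by (metis mult.assoc mult.commute)
    have eq2: "u w v * ip (\<lambda>z. \<alpha> v * cnj (b v l) * p v z) (\<lambda>z. \<alpha> w * cnj (b w l) * p w z)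
      = u w v * (\<alpha> v * cnj (\<alpha> w) * (b w l * cnj (b v l)) * ip (p v) (p w))" for v w
      by (simp add: ip_scale ip_scale_right p scale_mem)
    show ?thesis
      using row_contraction(2)[OF Y, of "\<lambda>v z. \<alpha> v * cnj (b v l) * p v z", OF scale_mem[OF p]]
      unfolding eq1 eq2 .
  qed
  have "Re (S E) = Re (\<Sum>v\<in>Y. \<Sum>w\<in>Y. k w v * ip (\<lambda>z. \<alpha> v * (p v z - f z)) (\<lambda>z. \<alpha> w * (p w z - f z)))"
    by (simp add: S_def E_def ip_scale ip_scale_right p f diff_mem scale_mem mult_ac)
  also have "\<dots> = (\<Sum>l\<in>Y. (nrm (\<lambda>z. \<Sum>v\<in>Y. cnj (b v l) * (\<alpha> v * (p v z - f z))))\<^sup>2)"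
    by (intro sum_nrm_sq[symmetric] scale_mem diff_mem p f b)
  also have "\<dots> \<le> (\<Sum>l\<in>Y. Re (\<Sum>v\<in>Y. \<Sum>w\<in>Y. u w v * (\<alpha> v * cnj (\<alpha> w) * (b w l * cnj (b v l)) * ip (p v) (p w))))"
    by (rule sum_mono[OF row])
  also have "\<dots> = Re (S G)"
  proof -
    have "(\<Sum>l\<in>Y. \<Sum>v\<in>Y. \<Sum>w\<in>Y. u w v * (\<alpha> v * cnj (\<alpha> w) * (b w l * cnj (b v l)) * ip (p v) (p w)))
      = (\<Sum>v\<in>Y. \<Sum>l\<in>Y. \<Sum>w\<in>Y. u w v * (\<alpha> v * cnj (\<alpha> w) * (b w l * cnj (b v l)) * ip (p v) (p w)))"
      by (rule sum.swap)
    also have "\<dots> = (\<Sum>v\<in>Y. \<Sum>w\<in>Y. \<Sum>l\<in>Y. u w v * (\<alpha> v * cnj (\<alpha> w) * (b w l * cnj (b v l)) * ip (p v) (p w)))"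
      by (intro sum.cong refl sum.swap)
    also have "\<dots> = S G"
      unfolding S_def G_def
      by (intro sum.cong refl) (simp add: b sum_distrib_left sum_distrib_right mult_ac)
    finally show ?thesis by (simp only: Re_sum[symmetric])
  qed
  finally have EG: "Re (S E) \<le> Re (S G)" .
  have DE: "D v w = G v w - E v w + ip (p v) (p w)" for v w
  proof -
    have "G v w = (k w v - 1) * ip (p v) (p w)"
      by (simp add: G_def kernel_u)
    then show ?thesis
      by (simp add: D_def E_def ip_diff ip_diff_right p f diff_mem algebra_simps)
  qed
  have "S D = S G - S E + S (\<lambda>v w. ip (p v) (p w))"
    by (simp only: S_def DE distrib_left right_diff_distrib sum.distrib sum_subtractf)
  also have "S (\<lambda>v w. ip (p v) (p w)) = ip (\<lambda>z. kc Y \<alpha> z * f z) (\<lambda>z. kc Y \<alpha> z * f z)"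
  proof -
    have "(\<lambda>z. kc Y \<alpha> z * f z) = (\<lambda>z. \<Sum>v\<in>Y. \<alpha> v * p v z)"
      by (simp add: kc_def p_def sum_distrib_right mult.assoc)
    then show ?thesis by (simp add: ip_sum_sum p S_def)
  qed
  finally have le: "(nrm (\<lambda>z. kc Y \<alpha> z * f z))\<^sup>2 \<le> Re (S D)"
    using EG by (simp add: nrm_sq kc_mult_mem f)
  \<comment> \<open>The definition of \<open>sarason\<close> doubles one of the two mixed terms of
    \<open>D\<close>. They are complex conjugates, so the real part does not change.\<close>
  define T1 where "T1 = S (\<lambda>v w. k w v * ip f (p w))"
  define T2 where "T2 = S (\<lambda>v w. k w v * ip (p v) f)"
  have "cnj T1 = (\<Sum>v\<in>Y. \<Sum>w\<in>Y. \<alpha> w * cnj (\<alpha> v) * (k v w * ip (p w) f))"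
    unfolding T1_def S_def cnj_sum complex_cnj_mult complex_cnj_cnj
      kernel_cnj[symmetric] ip_cnj[OF f p, symmetric]
    by (simp only: mult_ac)
  also have "\<dots> = T2" unfolding T2_def S_def by (rule sum.swap)
  finally have "Re (cnj T1) = Re T2" by (rule arg_cong)
  then have "Re T1 = Re T2" by simp
  moreover have "S D = T2 + T1 - S (\<lambda>v w. k w v * ip f f)"
    by (simp only: S_def T1_def T2_def D_def distrib_left right_diff_distrib sum.distrib sum_subtractf)
  moreover have "(\<Sum>w\<in>Y. cnj (\<alpha> w) * sarason f w * kc Y \<alpha> w) = 2 * T1 - S (\<lambda>v w. k w v * ip f f)"
  proof -
    have "(\<Sum>w\<in>Y. cnj (\<alpha> w) * sarason f w * kc Y \<alpha> w)
      = (\<Sum>w\<in>Y. \<Sum>v\<in>Y. 2 * (\<alpha> v * cnj (\<alpha> w) * (k w v * ip f (p w))) - \<alpha> v * cnj (\<alpha> w) * (k w v * ip f f))"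
      unfolding kc_def sum_distrib_left
      by (intro sum.cong refl) (simp add: sarason_def p_def algebra_simps)
    also have "\<dots> = (\<Sum>v\<in>Y. \<Sum>w\<in>Y. 2 * (\<alpha> v * cnj (\<alpha> w) * (k w v * ip f (p w))) - \<alpha> v * cnj (\<alpha> w) * (k w v * ip f f))"
      by (rule sum.swap)
    also have "\<dots> = 2 * T1 - S (\<lambda>v w. k w v * ip f f)"
      by (simp add: S_def T1_def sum_subtractf sum_distrib_left)
    finally show ?thesis .
  qed
  ultimately show ?thesis using le by simp
qed

end

section \<open>Common denominators\<close>

context complete_Pick_space
begin

text \<open>If \<open>C\<close> bounds multiplication by \<open>k\<^sub>w\<close>, then each term is
  at most \<open>(2 * C + 1) * (nrm (F n))\<^sup>2\<close>.\<close>

lemma summable_sarason: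
  assumes F: "\<And>n. F n \<in> H" and "summable (\<lambda>n. (nrm (F n))\<^sup>2)"
  shows "summable (\<lambda>n. sarason (F n) w)"
proof -
  obtain C where C: "0 \<le> C" and bd: "\<And>h. h \<in> H \<Longrightarrow> nrm (\<lambda>z. k z w * h z) \<le> C * nrm h"
    using kernel_multiplier[of w] by metis
  have "norm (sarason f w) \<le> (2 * C + 1) * (nrm f)\<^sup>2" if f: "f \<in> H" for f
  proof -
    have "norm (sarason f w) \<le> norm (2 * ip f (\<lambda>z. k z w * f z)) + norm (ip f f)"
      unfolding sarason_def by (rule norm_triangle_ineq4)
    also have "\<dots> = 2 * cmod (ip f (\<lambda>z. k z w * f z)) + (nrm f)\<^sup>2"
      by (simp add: norm_mult ip_self f norm_power nrm_nonneg)
    also have "cmod (ip f (\<lambda>z. k z w * f z)) \<le> nrm f * (C * nrm f)"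
      by (rule order_trans[OF Cauchy_Schwarz[OF f kernel_mult_mem[OF f]]])
        (intro mult_left_mono bd f nrm_nonneg)
    finally show ?thesis by (simp add: power2_eq_square algebra_simps)
  qed
  then have "norm (sarason (F n) w) \<le> (2 * C + 1) * (nrm (F n))\<^sup>2" for n
    using F .
  then show ?thesis
    by (rule summable_comparison_test'[OF summable_mult[OF assms(2)], where N = 0])
qed

context
  fixes F :: "nat \<Rightarrow> 'x \<Rightarrow> complex"
  assumes F_mem: "\<And>n. F n \<in> H" and F_0: "F 0 = (\<lambda>_. 1)"
    and F_summable: "summable (\<lambda>n. (nrm (F n))\<^sup>2)"
begin

text \<open>This is the \<open>V\<close> of the introduction. The entry \<open>F 0 = 1\<close> makes
  its form at \<open>t\<close> dominate \<open>(nrm t)\<^sup>2\<close>, which yields both the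
  absence of zeros and the accretivity of \<open>denom\<close>.\<close>

definition sarason_sum :: "'x \<Rightarrow> complex"
  where "sarason_sum w = (\<Sum>n. sarason (F n) w)"

definition denom :: "'x \<Rightarrow> complex"
  where "denom w = 1 / sarason_sum w"

text \<open>The inequality \<open>Re_sarason\<close> is summed over \<open>n\<close>; since it also
  shows all terms \<open>q n\<close> to be nonnegative, partial sums stay below the full
  series.\<close>

lemma sum_le_Re_sarason_sum:
  assumes Y: "finite Y"
  shows "(\<Sum>n<N. (nrm (\<lambda>z. kc Y \<alpha> z * F n z))\<^sup>2) \<le> Re (\<Sum>w\<in>Y. cnj (\<alpha> w) * sarason_sum w * kc Y \<alpha> w)"
proof -
  define q where "q n = Re (\<Sum>w\<in>Y. cnj (\<alpha> w) * sarason (F n) w * kc Y \<alpha> w)" for n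
  have q: "q sums Re (\<Sum>w\<in>Y. cnj (\<alpha> w) * sarason_sum w * kc Y \<alpha> w)"
    unfolding sarason_sum_def q_def
    by (intro sums_Re sums_sum sums_mult sums_mult2 summable_sums summable_sarason F_mem F_summable)
  have le: "(nrm (\<lambda>z. kc Y \<alpha> z * F n z))\<^sup>2 \<le> q n" for n
    unfolding q_def by (rule Re_sarason[OF F_mem Y])
  then have nonneg: "0 \<le> q n" for n
    by (rule order_trans[OF zero_le_power2])
  have "(\<Sum>n<N. (nrm (\<lambda>z. kc Y \<alpha> z * F n z))\<^sup>2) \<le> (\<Sum>n<N. q n)"
    by (intro sum_mono le)
  also have "\<dots> \<le> suminf q"
    by (intro sum_le_suminf sums_summable[OF q]) (simp_all add: nonneg)
  also have "suminf q = Re (\<Sum>w\<in>Y. cnj (\<alpha> w) * sarason_sum w * kc Y \<alpha> w)"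
    by (rule sums_unique[OF q, symmetric])
  finally show ?thesis .
qed

text \<open>At a single kernel the form dominates the squared norm of that kernel, which is
  positive.\<close>

lemma sarason_sum_nz: "sarason_sum w \<noteq> 0"
proof
  assume "sarason_sum w = 0"
  then have "(\<Sum>n<1. (nrm (\<lambda>z. kc {w} (\<lambda>_. 1) z * F n z))\<^sup>2) \<le> 0"
    using sum_le_Re_sarason_sum[where Y = "{w}" and N = 1 and \<alpha> = "\<lambda>_. 1"] by simp
  then have "nrm (\<lambda>z. k z w) = 0" by (simp add: F_0 kc_def)
  then have "(\<lambda>z. k z w) = (\<lambda>z. 0)" by (rule nrm_eq_0[OF kernel_mem])
  then show False using kernel_nz by metis
qed

lemma denom_nz: "denom w \<noteq> 0"
  by (simp add: denom_def sarason_sum_nz)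

text \<open>
  Here \<open>t\<close> is the adjoint of the column \<open>(denom * F n)\<close>, \<open>n < N\<close>, applied to the vectors
  \<open>kc Y (a n)\<close>. With \<open>Q\<close> the form of \<open>sarason_sum\<close> at \<open>t\<close>, the identity
  \<open>denom * sarason_sum = 1\<close> yields \<open>Q = Re (\<Sum>n<N. \<langle>t F\<^sub>n, kc Y (a n)\<rangle>)\<close>, hence
  \<open>2 Q \<le> Q + (\<Sum>n<N. \<parallel>kc Y (a n)\<parallel>\<^sup>2)\<close>.
\<close>

lemma column_adjoint:
  fixes a :: "nat \<Rightarrow> 'x \<Rightarrow> complex"
  assumes Y: "finite Y" and N: "0 < N"
  defines "t \<equiv> kc Y (\<lambda>w. \<Sum>n<N. a n w * cnj (denom w * F n w))"
  shows "(nrm t)\<^sup>2 \<le> Re (\<Sum>n<N. ip (\<lambda>z. t z * F n z) (kc Y (a n)))"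
    "(nrm t)\<^sup>2 \<le> (\<Sum>n<N. (nrm (kc Y (a n)))\<^sup>2)"
proof -
  define \<alpha> where "\<alpha> w = (\<Sum>n<N. a n w * cnj (denom w * F n w))" for w
  have t: "t = kc Y \<alpha>" unfolding t_def \<alpha>_def[abs_def] ..
  have tF: "(\<lambda>z. t z * F n z) \<in> H" for n unfolding t by (rule kc_mult_mem[OF F_mem])
  define Q where "Q = Re (\<Sum>w\<in>Y. cnj (\<alpha> w) * sarason_sum w * t w)"
  have \<alpha>sarason_sum: "cnj (\<alpha> w) * sarason_sum w = (\<Sum>n<N. cnj (a n w) * F n w)" for w
    using sarason_sum_nz[of w] by (simp add: \<alpha>_def sum_distrib_right denom_def)
  have "(\<Sum>w\<in>Y. cnj (\<alpha> w) * sarason_sum w * t w) = (\<Sum>w\<in>Y. \<Sum>n<N. cnj (a n w) * (t w * F n w))"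
    by (simp add: \<alpha>sarason_sum sum_distrib_left mult_ac)
  also have "\<dots> = (\<Sum>n<N. ip (\<lambda>z. t z * F n z) (kc Y (a n)))"
    unfolding ip_kc[OF tF] by (rule sum.swap)
  finally have Q: "Q = Re (\<Sum>n<N. ip (\<lambda>z. t z * F n z) (kc Y (a n)))" by (simp add: Q_def)
  have le: "(\<Sum>n<N. (nrm (\<lambda>z. t z * F n z))\<^sup>2) \<le> Q"
    unfolding Q_def t by (rule sum_le_Re_sarason_sum[OF Y])
  have "(nrm t)\<^sup>2 = (nrm (\<lambda>z. t z * F 0 z))\<^sup>2" by (simp add: F_0)
  also have "\<dots> \<le> (\<Sum>n<N. (nrm (\<lambda>z. t z * F n z))\<^sup>2)"
    using N by (intro member_le_sum) auto
  finally have tQ: "(nrm t)\<^sup>2 \<le> Q" using le by linarith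
  then show "(nrm t)\<^sup>2 \<le> Re (\<Sum>n<N. ip (\<lambda>z. t z * F n z) (kc Y (a n)))" by (simp only: Q)
  have "2 * Q = (\<Sum>n<N. 2 * Re (ip (\<lambda>z. t z * F n z) (kc Y (a n))))"
    by (simp only: Q Re_sum sum_distrib_left)
  also have "\<dots> \<le> (\<Sum>n<N. (nrm (\<lambda>z. t z * F n z))\<^sup>2 + (nrm (kc Y (a n)))\<^sup>2)"
    by (intro sum_mono two_Re_ip_le tF kc_mem)
  finally have "2 * Q \<le> Q + (\<Sum>n<N. (nrm (kc Y (a n)))\<^sup>2)"
    using le by (simp add: sum.distrib)
  then show "(nrm t)\<^sup>2 \<le> (\<Sum>n<N. (nrm (kc Y (a n)))\<^sup>2)" using tQ by linarith
qed

lemma denom_column_mult: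
  assumes h: "h \<in> H"
  shows "(\<lambda>z. denom z * F n z * h z) \<in> H" "nrm (\<lambda>z. denom z * F n z * h z) \<le> nrm h"
proof -
  have bound: "cmod (\<Sum>y\<in>Y. cnj (a y) * (denom y * F n y * h y)) \<le> nrm h * nrm (kc Y a)"
    if Y: "finite Y" for Y a
  proof -
    \<comment> \<open>Only the entry with index \<open>n\<close> is occupied, so the adjoint of the
      column reduces to that of one multiplication.\<close>
    define b where "b m = (if m = n then a else (\<lambda>_. 0))" for m
    define t where "t = kc Y (\<lambda>w. \<Sum>m<Suc n. b m w * cnj (denom w * F m w))"
    have "(\<Sum>m<Suc n. b m w * cnj (denom w * F m w)) = a w * cnj (denom w * F n w)" for w
      by (simp add: b_def)
    then have "(\<Sum>y\<in>Y. cnj (a y) * (denom y * F n y * h y)) = ip h t"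
      by (simp add: t_def ip_kc h mult_ac)
    also have "cmod \<dots> \<le> nrm h * nrm t"
      unfolding t_def by (rule Cauchy_Schwarz[OF h kc_mem])
    also have "nrm t \<le> nrm (kc Y a)"
    proof -
      have "(nrm t)\<^sup>2 \<le> (\<Sum>m<Suc n. (nrm (kc Y (b m)))\<^sup>2)"
        unfolding t_def by (rule column_adjoint(2)[OF Y]) simp
      also have "\<dots> = (nrm (kc Y a))\<^sup>2"
        by (simp add: b_def kc_def nrm_zero)
      finally show ?thesis by (rule power2_le_imp_le) (simp add: nrm_nonneg kc_mem)
    qed
    finally show ?thesis by (simp add: mult_left_mono nrm_nonneg h)
  qed
  show "(\<lambda>z. denom z * F n z * h z) \<in> H" "nrm (\<lambda>z. denom z * F n z * h z) \<le> nrm h"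
    using kernel_Riesz_norm[OF nrm_nonneg[OF h], of "\<lambda>z. denom z * F n z * h z"] bound by blast+
qed

lemma denom_mult:
  assumes h: "h \<in> H"
  shows "(\<lambda>z. denom z * h z) \<in> H" "nrm (\<lambda>z. denom z * h z) \<le> nrm h"
  using denom_column_mult[OF h, of 0] by (simp_all add: F_0)

text \<open>This is the dual of \<open>column_adjoint(2)\<close>. Pairing the column with kernel
  combinations \<open>x n\<close> gives \<open>ip h t\<close>, and twice its real part is at most
  \<open>(nrm h)\<^sup>2 + (\<Sum>n<N. (nrm (x n))\<^sup>2)\<close>. Then the \<open>x n\<close>
  approximate the entries \<open>p n\<close>.\<close>

lemma denom_column:
  assumes h: "h \<in> H"
  shows "(\<Sum>n<N. (nrm (\<lambda>z. denom z * F n z * h z))\<^sup>2) \<le> (nrm h)\<^sup>2"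
proof (cases "N = 0")
  case False
  define p where "p n = (\<lambda>z. denom z * F n z * h z)" for n
  have p: "p n \<in> H" for n unfolding p_def by (rule denom_column_mult(1)[OF h])
  have "(\<Sum>n<N. (nrm (p n))\<^sup>2) \<le> (nrm h)\<^sup>2 + e" if e: "0 < e" for e
  proof -
    \<comment> \<open>The \<open>N\<close> squared errors \<open>d\<^sup>2\<close> add up to
      \<open>e\<close>.\<close>
    define d where "d = sqrt (e / N)"
    have d: "0 < d" "d\<^sup>2 = e / N" using e False by (auto simp: d_def)
    have "\<forall>n. \<exists>Y a. finite Y \<and> nrm (\<lambda>x. p n x - kc Y a x) < d"
      using kc_dense[OF p d(1)] by blast
    then obtain Y a where Y: "\<And>n. finite (Y n)" and lt: "\<And>n. nrm (\<lambda>x. p n x - kc (Y n) (a n) x) < d"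
      by metis
    define Z where "Z = (\<Union>n<N. Y n)"
    have Z: "finite Z" using Y by (simp add: Z_def)
    define b where "b n y = (if y \<in> Y n then a n y else 0)" for n y
    define x where "x n = kc Z (b n)" for n
    have x: "x n \<in> H" for n unfolding x_def by (rule kc_mem)
    have x_eq: "x n = kc (Y n) (a n)" if "n < N" for n
      unfolding x_def b_def[abs_def] using that by (intro kc_mono_neutral Z) (auto simp: Z_def)
    define t where "t = kc Z (\<lambda>w. \<Sum>n<N. b n w * cnj (denom w * F n w))"
    have t: "t \<in> H" unfolding t_def by (rule kc_mem)
    have tx: "(nrm t)\<^sup>2 \<le> (\<Sum>n<N. (nrm (x n))\<^sup>2)"
      unfolding t_def x_def using False by (intro column_adjoint(2)[OF Z]) simp
    have "(\<Sum>n<N. ip (p n) (x n)) = (\<Sum>n<N. \<Sum>y\<in>Z. cnj (b n y) * (denom y * F n y) * h y)"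
      unfolding x_def ip_kc[OF p] by (simp add: p_def mult.assoc)
    also have "\<dots> = (\<Sum>y\<in>Z. \<Sum>n<N. cnj (b n y) * (denom y * F n y) * h y)"
      by (rule sum.swap)
    also have "\<dots> = ip h t"
      by (simp add: t_def ip_kc h sum_distrib_right)
    finally have ht: "(\<Sum>n<N. ip (p n) (x n)) = ip h t" .
    have "(\<Sum>n<N. (nrm (p n))\<^sup>2)
      = (\<Sum>n<N. (nrm (\<lambda>z. p n z - x n z))\<^sup>2 + 2 * Re (ip (p n) (x n)) - (nrm (x n))\<^sup>2)"
      by (intro sum.cong refl) (simp add: nrm_sq_diff p x)
    also have "\<dots> = (\<Sum>n<N. (nrm (\<lambda>z. p n z - x n z))\<^sup>2) + 2 * Re (ip h t) - (\<Sum>n<N. (nrm (x n))\<^sup>2)"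
      by (simp add: sum.distrib sum_subtractf flip: ht sum_distrib_left)
    also have "2 * Re (ip h t) \<le> (nrm h)\<^sup>2 + (nrm t)\<^sup>2" by (rule two_Re_ip_le[OF h t])
    also have "(\<Sum>n<N. (nrm (\<lambda>z. p n z - x n z))\<^sup>2) \<le> (\<Sum>n<N. d\<^sup>2)"
    proof (intro sum_mono power_mono)
      fix n assume "n \<in> {..<N}"
      then show "nrm (\<lambda>z. p n z - x n z) \<le> d" using lt[of n] by (simp add: x_eq less_imp_le)
    qed (simp add: nrm_nonneg diff_mem p x)
    also have "(\<Sum>n<N. d\<^sup>2) = e" using False by (simp add: d(2))
    finally show ?thesis using tx by simp
  qed
  then show ?thesis unfolding p_def by (rule field_le_epsilon)
qed simp

text \<open>On the span of the kernels this is \<open>column_adjoint(1)\<close> with the single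
  entry \<open>F 0 = 1\<close>; boundedness of \<open>denom\<close> extends it to
  \<open>H\<close>.\<close>

lemma denom_accretive:
  assumes h: "h \<in> H"
  shows "0 \<le> Re (ip (\<lambda>z. denom z * h z) h)"
proof -
  have kc: "0 \<le> Re (ip (\<lambda>z. denom z * kc Y a z) (kc Y a))" if Y: "finite Y" for Y a
  proof -
    define t where "t = kc Y (\<lambda>w. \<Sum>n<1::nat. a w * cnj (denom w * F n w))"
    have t: "t \<in> H" unfolding t_def by (rule kc_mem)
    have "(nrm t)\<^sup>2 \<le> Re (ip t (kc Y a))"
      using column_adjoint(1)[OF Y, where N = 1 and a = "\<lambda>_. a"] by (simp add: F_0 t_def)
    also have "\<dots> = Re (ip (kc Y a) t)"
      using ip_cnj[OF kc_mem[of Y a] t] by simp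
    also have "ip (kc Y a) t = ip (\<lambda>z. denom z * kc Y a z) (kc Y a)"
      by (simp add: t_def F_0 ip_kc kc_mem denom_mult mult.assoc)
    finally show ?thesis by (rule order_trans[OF zero_le_power2])
  qed
  obtain Y a where Y: "\<And>n. finite (Y n)"
    and lim: "(\<lambda>n. nrm (\<lambda>x. h x - kc (Y n) (a n) x)) \<longlonglongrightarrow> 0"
    using kc_approx_seq[OF h] by blast
  define d where "d n = nrm (\<lambda>x. h x - kc (Y n) (a n) x)" for n
  have ge: "- (d n * (nrm h + (nrm h + d n))) \<le> Re (ip (\<lambda>z. denom z * h z) h)" for n
  proof -
    define x where "x = kc (Y n) (a n)"
    define g where "g = (\<lambda>z. h z - x z)"
    have x: "x \<in> H" and g: "g \<in> H" by (simp_all add: x_def g_def kc_mem h diff_mem)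
    have d: "d n = nrm g" by (simp add: d_def g_def x_def)
    have "nrm x \<le> nrm h + nrm g"
      using hnorm_triangle[OF h diff_mem[OF x h]] nrm_minus_commute[OF x h] by (simp add: g_def)
    \<comment> \<open>The error of replacing \<open>h\<close> by \<open>x\<close> is split so that
      each term contains the small function \<open>g\<close> once.\<close>
    have "ip (\<lambda>z. denom z * h z) h - ip (\<lambda>z. denom z * x z) x = ip (\<lambda>z. denom z * g z) h + ip (\<lambda>z. denom z * x z) g"
    proof -
      have "(\<lambda>z. denom z * g z) = (\<lambda>z. denom z * h z - denom z * x z)" by (simp add: g_def right_diff_distrib)
      then show ?thesis by (simp add: g_def ip_diff ip_diff_right denom_mult h x)
    qed
    then have "Re (ip (\<lambda>z. denom z * h z) h) - Re (ip (\<lambda>z. denom z * x z) x)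
      = Re (ip (\<lambda>z. denom z * g z) h + ip (\<lambda>z. denom z * x z) g)"
      by (metis minus_complex.simps(1))
    moreover have "\<bar>Re (ip (\<lambda>z. denom z * g z) h + ip (\<lambda>z. denom z * x z) g)\<bar>
      \<le> cmod (ip (\<lambda>z. denom z * g z) h) + cmod (ip (\<lambda>z. denom z * x z) g)"
      by (rule order_trans[OF abs_Re_le_cmod norm_triangle_ineq])
    moreover have "cmod (ip (\<lambda>z. denom z * g z) h) \<le> nrm g * nrm h"
      by (rule order_trans[OF Cauchy_Schwarz])
        (intro denom_mult g h mult_right_mono nrm_nonneg)+
    moreover have "cmod (ip (\<lambda>z. denom z * x z) g) \<le> (nrm h + nrm g) * nrm g"
      by (rule order_trans[OF Cauchy_Schwarz])
        (intro denom_mult g x mult_right_mono nrm_nonneg order_trans[OF denom_mult(2)[OF x] \<open>nrm x \<le> _\<close>])+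
    moreover have "0 \<le> Re (ip (\<lambda>z. denom z * x z) x)" unfolding x_def by (rule kc[OF Y])
    ultimately show ?thesis unfolding d by (simp add: algebra_simps)
  qed
  have "(\<lambda>n. - (d n * (nrm h + (nrm h + d n)))) \<longlonglongrightarrow> - (0 * (nrm h + (nrm h + 0)))"
    using lim by (intro tendsto_intros) (simp_all add: d_def)
  then have "- (0 * (nrm h + (nrm h + 0))) \<le> Re (ip (\<lambda>z. denom z * h z) h)"
    by (rule LIMSEQ_le_const2) (use ge in blast)
  then show ?thesis by simp
qed

end

end

section \<open>Weak products\<close>

context hilbert_function_space
begin

text \<open>Riesz for the functional \<open>\<lambda>s. ip s x\<close> on \<open>S\<close> yields an
  \<open>F\<close> in the closure of \<open>S\<close>, the orthogonal projection of
  \<open>x\<close>. The difference of \<open>x\<close> and \<open>F\<close> is orthogonal to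
  \<open>S\<close>, hence 0.\<close>

lemma norm_dense_orthogonal:
  assumes S: "S \<subseteq> H" and S0: "(\<lambda>x. 0) \<in> S"
    and add: "\<And>f g. f \<in> S \<Longrightarrow> g \<in> S \<Longrightarrow> (\<lambda>x. f x + g x) \<in> S"
    and scale: "\<And>c f. f \<in> S \<Longrightarrow> (\<lambda>x. c * f x) \<in> S"
    and orth: "\<And>x. x \<in> H \<Longrightarrow> (\<And>s. s \<in> S \<Longrightarrow> ip s x = 0) \<Longrightarrow> x = (\<lambda>_. 0)"
  shows "norm_dense H nrm S"
proof -
  have dense: "\<exists>s\<in>S. nrm (\<lambda>z. x z - s z) < e" if x: "x \<in> H" and e: "0 < e" for x e
  proof -
    define R where "R = {(s, ip s x) |s. s \<in> S}"
    have SH: "s \<in> H" if "s \<in> S" for s using S that by blast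
    have "\<exists>F\<in>H. (\<forall>g c. (g, c) \<in> R \<longrightarrow> ip g F = c) \<and>
      (\<forall>e>0. \<exists>g c. (g, c) \<in> R \<and> nrm (\<lambda>x. F x - g x) < e)"
    proof (rule Riesz)
      show "(\<lambda>x. 0, 0) \<in> R" using S0 ip_zero[OF x] by (force simp: R_def)
      show "cmod c \<le> nrm x * nrm g" if "(g, c) \<in> R" for g c
        using that Cauchy_Schwarz[OF SH x, of g] by (auto simp: R_def mult.commute)
      show "(\<lambda>x. f x + g x, b + c) \<in> R" if "(f, b) \<in> R" "(g, c) \<in> R" for f b g c
        using that by (auto simp: R_def ip_add SH x intro: add)
      show "(\<lambda>x. s * g x, s * c) \<in> R" if "(g, c) \<in> R" for g c s
        using that by (auto simp: R_def ip_scale SH x intro: scale)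
    qed (auto simp: R_def SH)
    then obtain F where F: "F \<in> H" and ipF: "\<And>g c. (g, c) \<in> R \<Longrightarrow> ip g F = c"
      and approx: "\<And>e. 0 < e \<Longrightarrow> \<exists>g c. (g, c) \<in> R \<and> nrm (\<lambda>x. F x - g x) < e"
      by blast
    have ipF': "ip s F = ip s x" if "s \<in> S" for s
      using ipF[of s "ip s x"] that by (auto simp: R_def)
    have "(\<lambda>z. x z - F z) = (\<lambda>_. 0)"
      by (rule orth) (simp_all add: diff_mem x F ip_diff_right SH ipF')
    then have "x = F" by (simp add: fun_eq_iff)
    with approx[OF e] show ?thesis by (auto simp: R_def)
  qed
  have "norm_topology H nrm closure_of S = {x \<in> H. \<forall>r>0. \<exists>y\<in>S. y \<in> mball x r}"
    unfolding norm_topology_def by (rule metric_closure_of)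
  also have "\<dots> = H"
    using dense S by (fastforce simp: in_mball norm_dist_def)
  finally show ?thesis using S by (simp add: norm_dense_def)
qed

text \<open>
  On the Hardy space these are the contractive multipliers with nonnegative real part, which are
  outer.
\<close>

definition accretive_multiplier :: "('x \<Rightarrow> complex) \<Rightarrow> bool"
  where "accretive_multiplier \<phi> \<longleftrightarrow> (\<forall>w. \<phi> w \<noteq> 0) \<and> (\<forall>h\<in>H. (\<lambda>z. \<phi> z * h z) \<in> H \<and>
    nrm (\<lambda>z. \<phi> z * h z) \<le> nrm h \<and> 0 \<le> Re (ip (\<lambda>z. \<phi> z * h z) h))"

lemma accretive_multiplierD:
  assumes "accretive_multiplier \<phi>"
  shows "\<phi> w \<noteq> 0" "h \<in> H \<Longrightarrow> (\<lambda>z. \<phi> z * h z) \<in> H" "h \<in> H \<Longrightarrow> nrm (\<lambda>z. \<phi> z * h z) \<le> nrm h"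
    "h \<in> H \<Longrightarrow> 0 \<le> Re (ip (\<lambda>z. \<phi> z * h z) h)"
  using assms by (auto simp: accretive_multiplier_def)

text \<open>An accretive operator and its adjoint have the same kernel.\<close>

lemma accretive_multiplier_adjoint_injective:
  assumes \<phi>: "accretive_multiplier \<phi>" and x: "x \<in> H"
    and orth: "\<And>h. h \<in> H \<Longrightarrow> ip (\<lambda>z. \<phi> z * h z) x = 0"
  shows "x = (\<lambda>_. 0)"
proof -
  note \<phi>D = accretive_multiplierD[OF \<phi>]
  define h where "h = (\<lambda>z. \<phi> z * x z)"
  have h: "h \<in> H" unfolding h_def by (rule \<phi>D(2)[OF x])
  define R where "R = Re (ip (\<lambda>z. \<phi> z * h z) h)"
  have R: "0 \<le> R" unfolding R_def by (rule \<phi>D(4)[OF h])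
  \<comment> \<open>Accretivity is tested at \<open>x + t * h\<close>; the terms paired with
    \<open>x\<close> vanish by \<open>orth\<close>.\<close>
  have ineq: "0 \<le> t * (nrm h)\<^sup>2 + t\<^sup>2 * R" for t :: real
  proof -
    let ?y = "\<lambda>z. x z + of_real t * h z"
    have y: "?y \<in> H" using x h by (intro add_mem scale_mem)
    have "(\<lambda>z. \<phi> z * ?y z) = (\<lambda>z. h z + of_real t * (\<phi> z * h z))"
      by (simp add: h_def algebra_simps)
    then have "ip (\<lambda>z. \<phi> z * ?y z) ?y = ip h ?y + of_real t * ip (\<lambda>z. \<phi> z * h z) ?y"
      by (simp add: ip_add ip_scale h y \<phi>D scale_mem)
    also have "\<dots> = of_real t * ip h h + of_real t * (of_real t * ip (\<lambda>z. \<phi> z * h z) h)"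
      using orth[OF x] orth[OF h]
      by (simp add: ip_add_right ip_scale_right h x \<phi>D scale_mem flip: h_def)
    finally have "Re (ip (\<lambda>z. \<phi> z * ?y z) ?y) = t * (nrm h)\<^sup>2 + t\<^sup>2 * R"
      by (simp add: R_def ip_self h power2_eq_square)
    then show ?thesis using \<phi>D(4)[OF y] by simp
  qed
  \<comment> \<open>At \<open>t = - r\<close> the inequality collapses to
    \<open>0 \<le> - r\<^sup>2\<close>; the 1 keeps the denominator positive if
    \<open>R = 0\<close>.\<close>
  define r where "r = (nrm h)\<^sup>2 / (1 + R)"
  have r: "(nrm h)\<^sup>2 = r * (1 + R)" using R by (simp add: r_def)
  have "0 \<le> - (r\<^sup>2)"
    using ineq[of "- r"] unfolding r by (simp add: algebra_simps power2_eq_square)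
  then have "nrm h = 0" using r by simp
  then have "h = (\<lambda>_. 0)" by (rule nrm_eq_0[OF h])
  then show ?thesis using \<phi>D(1) by (simp add: h_def fun_eq_iff)
qed

lemma accretive_multiplier_adjoint:
  assumes \<phi>: "accretive_multiplier \<phi>" and x: "x \<in> H"
  shows "\<exists>p\<in>H. \<forall>h\<in>H. ip (\<lambda>z. \<phi> z * h z) x = ip h p"
proof -
  note \<phi>D = accretive_multiplierD[OF \<phi>]
  define R where "R = {(h, ip (\<lambda>z. \<phi> z * h z) x) |h. h \<in> H}"
  have "\<exists>F\<in>H. (\<forall>g c. (g, c) \<in> R \<longrightarrow> ip g F = c) \<and>
    (\<forall>e>0. \<exists>g c. (g, c) \<in> R \<and> nrm (\<lambda>x. F x - g x) < e)"
  proof (rule Riesz)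
    show "(\<lambda>x. 0, 0) \<in> R" using zero_mem ip_zero[OF x] by (force simp: R_def)
    show "cmod c \<le> nrm x * nrm g" if "(g, c) \<in> R" for g c
    proof -
      from that have g: "g \<in> H" and c: "c = ip (\<lambda>z. \<phi> z * g z) x" by (auto simp: R_def)
      have "cmod c \<le> nrm (\<lambda>z. \<phi> z * g z) * nrm x"
        unfolding c by (rule Cauchy_Schwarz[OF \<phi>D(2)[OF g] x])
      also have "\<dots> \<le> nrm g * nrm x"
        by (intro mult_right_mono \<phi>D(3) g nrm_nonneg x)
      finally show ?thesis by (simp add: mult.commute)
    qed
    show "(\<lambda>x. f x + g x, b + c) \<in> R" if "(f, b) \<in> R" "(g, c) \<in> R" for f b g c
      using that by (auto simp: R_def ip_add \<phi>D x distrib_left intro: add_mem)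
    show "(\<lambda>x. s * g x, s * c) \<in> R" if gc: "(g, c) \<in> R" for g c s
    proof -
      from gc have g: "g \<in> H" and c: "c = ip (\<lambda>z. \<phi> z * g z) x" by (auto simp: R_def)
      have "(\<lambda>z. \<phi> z * (s * g z)) = (\<lambda>z. s * (\<phi> z * g z))" by (simp add: mult_ac)
      then have "s * c = ip (\<lambda>z. \<phi> z * (s * g z)) x"
        by (simp add: c ip_scale \<phi>D g x)
      then show ?thesis unfolding R_def using scale_mem[OF g, of s] by blast
    qed
  qed (auto simp: R_def)
  then obtain p where p: "p \<in> H" and ip_p: "\<And>g c. (g, c) \<in> R \<Longrightarrow> ip g p = c"
    by blast
  have "ip (\<lambda>z. \<phi> z * h z) x = ip h p" if "h \<in> H" for h
    by (rule ip_p[symmetric]) (use that in \<open>auto simp: R_def\<close>)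
  with p show ?thesis by blast
qed

text \<open>Scaling one factor by \<open>sqrt (nrm g / nrm f)\<close> and the other by its inverse
  equalizes the norms. This turns summability of \<open>nrm f * nrm g\<close> into square
  summability of each sequence.\<close>

lemma balanced_factors:
  assumes f: "f \<in> H" and g: "g \<in> H"
  shows "\<exists>f' g'. f' \<in> H \<and> g' \<in> H \<and> (\<forall>x. f' x * g' x = f x * g x) \<and>
    (nrm f')\<^sup>2 = nrm f * nrm g \<and> (nrm g')\<^sup>2 = nrm f * nrm g"
proof (cases "nrm f * nrm g = 0")
  case True
  then have "f = (\<lambda>_. 0) \<or> g = (\<lambda>_. 0)" using nrm_eq_0 f g by auto
  then show ?thesis
    using True by (intro exI[of _ "\<lambda>_. 0"]) (auto simp: zero_mem nrm_zero)
next
  case False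
  then have pos: "0 < nrm f" "0 < nrm g" using nrm_nonneg[OF f] nrm_nonneg[OF g] by auto
  define s where "s = sqrt (nrm g / nrm f)"
  have s: "0 < s" "s\<^sup>2 = nrm g / nrm f" using pos by (auto simp: s_def)
  have "(nrm (\<lambda>x. of_real s * f x))\<^sup>2 = nrm f * nrm g"
    using pos s by (simp add: nrm_scale f power_mult_distrib power2_eq_square[of "nrm f"])
  moreover have "(nrm (\<lambda>x. of_real (1 / s) * g x))\<^sup>2 = nrm f * nrm g"
    using pos s unfolding nrm_scale[OF g]
    by (simp add: power_mult_distrib power_divide power2_eq_square[of "nrm g"] norm_divide)
  moreover have "(of_real s * f x) * (of_real (1 / s) * g x) = f x * g x" for x
    using s(1) by simp
  ultimately show ?thesis
    using scale_mem[OF f, of "of_real s"] scale_mem[OF g, of "of_real (1 / s)"] by blast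
qed

end

section \<open>Denominators of sequences and their cyclicity\<close>

context complete_Pick_space
begin

lemma common_denominator:
  assumes f: "\<And>n::nat. f n \<in> H" and summable: "summable (\<lambda>n. (nrm (f n))\<^sup>2)"
  shows "\<exists>\<phi>. accretive_multiplier \<phi> \<and> (\<forall>h\<in>H. (\<forall>n. (\<lambda>z. \<phi> z * f n z * h z) \<in> H) \<and>
    (\<forall>N. (\<Sum>n<N. (nrm (\<lambda>z. \<phi> z * f n z * h z))\<^sup>2) \<le> (nrm h)\<^sup>2))"
proof -
  \<comment> \<open>Prepending the constant 1 meets the requirement \<open>F 0 = 1\<close>; the
    column bound for \<open>f\<close> follows by dropping the entry 0.\<close>
  define F where "F = case_nat (\<lambda>_. 1) f"
  have F: "F n \<in> H" "F 0 = (\<lambda>_. 1)" "F (Suc n) = f n" for n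
    by (auto simp: F_def one_mem f split: nat.split)
  have "summable (\<lambda>n. (nrm (F (Suc n)))\<^sup>2)" using summable by (simp add: F(3))
  then have sF: "summable (\<lambda>n. (nrm (F n))\<^sup>2)" by (subst (asm) summable_Suc_iff)
  show ?thesis
  proof (intro exI[of _ "denom F"] conjI ballI allI)
    show "accretive_multiplier (denom F)"
      unfolding accretive_multiplier_def
      using denom_nz[OF F(1,2) sF] denom_mult[OF F(1,2) sF] denom_accretive[OF F(1,2) sF] by blast
    fix h assume h: "h \<in> H"
    show "(\<lambda>z. denom F z * f n z * h z) \<in> H" for n
      using denom_column_mult(1)[OF F(1,2) sF h, of "Suc n"] by (simp add: F(3))
    show "(\<Sum>n<N. (nrm (\<lambda>z. denom F z * f n z * h z))\<^sup>2) \<le> (nrm h)\<^sup>2" for N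
    proof -
      have "(\<Sum>n<N. (nrm (\<lambda>z. denom F z * f n z * h z))\<^sup>2)
        \<le> (nrm (\<lambda>z. denom F z * F 0 z * h z))\<^sup>2 + (\<Sum>n<N. (nrm (\<lambda>z. denom F z * F (Suc n) z * h z))\<^sup>2)"
        by (simp add: F(3))
      also have "\<dots> = (\<Sum>n<Suc N. (nrm (\<lambda>z. denom F z * F n z * h z))\<^sup>2)"
        by (rule sum.lessThan_Suc_shift[symmetric])
      also have "\<dots> \<le> (nrm h)\<^sup>2" by (rule denom_column[OF F(1,2) sF h])
      finally show ?thesis .
    qed
  qed
qed

text \<open>Kernels are multipliers. If \<open>x\<close> is orthogonal to their products with
  \<open>\<phi> * \<psi>\<close>, applying the adjoint of \<phi> and then that of \<psi> to
  \<open>x\<close> gives a function orthogonal to all kernels, hence 0. Both adjoints are injective,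
  so \<open>x\<close> is 0; accretivity of the product is not claimed.\<close>

lemma cyclic_accretive_product:
  assumes \<phi>: "accretive_multiplier \<phi>" and \<psi>: "accretive_multiplier \<psi>"
  shows "cyclic H nrm (\<lambda>z. \<phi> z * \<psi> z)"
proof -
  note D = accretive_multiplierD[OF \<phi>] accretive_multiplierD[OF \<psi>]
  define S where "S = {(\<lambda>z. m z * (\<phi> z * \<psi> z)) |m. m \<in> Mult H}"
  have S_I: "(\<lambda>z. m z * (\<phi> z * \<psi> z)) \<in> S" if "m \<in> Mult H" for m
    using that by (auto simp: S_def)
  have mem: "(\<lambda>z. \<phi> z * \<psi> z) \<in> H"
    using D(2)[OF D(6)[OF one_mem]] by simp
  have orth: "x = (\<lambda>_. 0)" if x: "x \<in> H" and zero: "\<And>s. s \<in> S \<Longrightarrow> ip s x = 0" for x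
  proof -
    obtain p where p: "p \<in> H" and xp: "\<And>h. h \<in> H \<Longrightarrow> ip (\<lambda>z. \<phi> z * h z) x = ip h p"
      using accretive_multiplier_adjoint[OF \<phi> x] by blast
    obtain q where q: "q \<in> H" and pq: "\<And>h. h \<in> H \<Longrightarrow> ip (\<lambda>z. \<psi> z * h z) p = ip h q"
      using accretive_multiplier_adjoint[OF \<psi> p] by blast
    have "q w = 0" for w
    proof -
      have "(\<lambda>z. k z w) \<in> Mult H" by (simp add: Mult_def kernel_mult_mem)
      then have "0 = ip (\<lambda>z. k z w * (\<phi> z * \<psi> z)) x" using zero[OF S_I] by simp
      also have "(\<lambda>z. k z w * (\<phi> z * \<psi> z)) = (\<lambda>z. \<phi> z * (\<psi> z * k z w))"
        by (simp add: mult_ac)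
      also have "ip \<dots> x = ip (\<lambda>z. k z w) q"
        by (simp add: xp pq D kernel_mem)
      also have "\<dots> = cnj (q w)"
        using ip_cnj[OF q kernel_mem] by (simp add: reproducing q)
      finally show ?thesis by simp
    qed
    then have "q = (\<lambda>_. 0)" by blast
    then have "ip (\<lambda>z. \<psi> z * h z) p = 0" if "h \<in> H" for h
      using pq[OF that] ip_zero_right[OF that] by simp
    then have "p = (\<lambda>_. 0)" by (rule accretive_multiplier_adjoint_injective[OF \<psi> p])
    then have "ip (\<lambda>z. \<phi> z * h z) x = 0" if "h \<in> H" for h
      using xp[OF that] ip_zero_right[OF that] by simp
    then show ?thesis by (rule accretive_multiplier_adjoint_injective[OF \<phi> x])
  qed
  have "norm_dense H nrm S"
  proof (rule norm_dense_orthogonal[OF _ _ _ _ orth])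
    show "S \<subseteq> H" using mem by (auto simp: S_def Mult_def)
    have "(\<lambda>_. 0) \<in> Mult H" by (simp add: Mult_def zero_mem)
    from S_I[OF this] show "(\<lambda>_. 0) \<in> S" by simp
    show "(\<lambda>x. f x + g x) \<in> S" if fg: "f \<in> S" "g \<in> S" for f g
    proof -
      from fg obtain m n where m: "m \<in> Mult H" "n \<in> Mult H"
        and f: "f = (\<lambda>z. m z * (\<phi> z * \<psi> z))" and g: "g = (\<lambda>z. n z * (\<phi> z * \<psi> z))"
        by (auto simp: S_def)
      have sum: "(\<lambda>z. m z + n z) \<in> Mult H" using m by (simp add: Mult_def distrib_right add_mem)
      have eq: "(\<lambda>x. f x + g x) = (\<lambda>z. (m z + n z) * (\<phi> z * \<psi> z))"
        by (simp add: f g distrib_right)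
      show ?thesis unfolding eq by (rule S_I[OF sum])
    qed
    show "(\<lambda>x. c * f x) \<in> S" if fS: "f \<in> S" for c f
    proof -
      from fS obtain m where m: "m \<in> Mult H" and f: "f = (\<lambda>z. m z * (\<phi> z * \<psi> z))"
        by (auto simp: S_def)
      have prod: "(\<lambda>z. c * m z) \<in> Mult H" using m by (simp add: Mult_def mult.assoc scale_mem)
      have eq: "(\<lambda>x. c * f x) = (\<lambda>z. (c * m z) * (\<phi> z * \<psi> z))"
        by (simp add: f mult.assoc)
      show ?thesis unfolding eq by (rule S_I[OF prod])
    qed
  qed
  then show ?thesis using mem by (simp add: cyclic_def S_def)
qed

end

section \<open>Double series enumerated along \<open>prod_decode\<close>\<close>

lemma sums_prod_decode:
  fixes p q :: "nat \<Rightarrow> complex"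
  assumes p: "p sums P" "summable (\<lambda>n. norm (p n))" and q: "q sums Q" "summable (\<lambda>n. norm (q n))"
  shows "(\<lambda>n. p (fst (prod_decode n)) * q (snd (prod_decode n))) sums (P * Q)"
proof -
  define r where "r = (\<lambda>x. p (fst x) * q (snd x))"
  have hp: "(p has_sum P) UNIV" and hq: "(q has_sum Q) UNIV"
    using norm_summable_imp_has_sum p q by blast+
  have np: "(\<lambda>n. norm (p n)) summable_on UNIV" and nq: "(\<lambda>n. norm (q n)) summable_on UNIV"
    using p(2) q(2) by (simp_all add: summable_on_UNIV_nonneg_real_iff)
  have "(\<lambda>x. norm (r x)) summable_on (UNIV \<times> UNIV)"
  proof (rule summable_on_SigmaI)
    show "((\<lambda>y. norm (r (x, y))) has_sum norm (p x) * (\<Sum>\<^sub>\<infinity>n. norm (q n))) UNIV" for x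
      using has_sum_cmult_right[OF has_sum_infsum[OF nq]] by (simp add: r_def norm_mult)
    show "(\<lambda>x. norm (p x) * (\<Sum>\<^sub>\<infinity>n. norm (q n))) summable_on UNIV"
      by (rule summable_on_cmult_left[OF np])
  qed simp
  then have "r summable_on (UNIV \<times> UNIV)" by (rule abs_summable_summable)
  moreover have "((\<lambda>y. r (x, y)) has_sum p x * Q) UNIV" for x
    using has_sum_cmult_right[OF hq] by (simp add: r_def)
  ultimately have "(r has_sum P * Q) (UNIV \<times> UNIV)"
    using has_sum_cmult_left[OF hp, of Q] by (intro has_sum_SigmaI) auto
  then have "((\<lambda>n. r (prod_decode n)) has_sum P * Q) UNIV"
    using has_sum_reindex_bij_betw[OF bij_prod_decode, of r "P * Q"] by simp
  then show ?thesis unfolding r_def by (rule has_sum_imp_sums)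
qed

text \<open>Both coordinates of \<open>prod_decode n\<close> are at most \<open>n\<close>, so the
  first \<open>N\<close> terms lie in a square of side \<open>N\<close>, whose columns are bounded
  by the \<open>B j\<close>.\<close>

lemma summable_prod_decode:
  fixes c :: "nat \<times> nat \<Rightarrow> real"
  assumes nonneg: "\<And>x. 0 \<le> c x" and le: "\<And>j N. (\<Sum>i<N. c (i, j)) \<le> B j" and B: "summable B"
  shows "summable (\<lambda>n. c (prod_decode n))"
proof (rule summableI_nonneg_bounded)
  fix N
  have B0: "0 \<le> B j" for j using le[where N = 0 and j = j] by simp
  have "(\<Sum>n<N. c (prod_decode n)) = sum c (prod_decode ` {..<N})"
    by (simp add: sum.reindex inj_prod_decode)
  also have "\<dots> \<le> sum c ({..<N} \<times> {..<N})"
  proof (rule sum_mono2)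
    show "prod_decode ` {..<N} \<subseteq> {..<N} \<times> {..<N}"
    proof (rule image_subsetI)
      fix n assume n: "n \<in> {..<N}"
      obtain i j where ij: "prod_decode n = (i, j)" by (cases "prod_decode n")
      then have "n = prod_encode (i, j)" by (metis prod_decode_inverse)
      then show "prod_decode n \<in> {..<N} \<times> {..<N}"
        using n ij le_prod_encode_1[of i j] le_prod_encode_2[of j i] by simp
    qed
  qed (simp_all add: nonneg)
  also have "\<dots> = (\<Sum>j<N. \<Sum>i<N. c (i, j))"
    unfolding sum.cartesian_product[symmetric, of "\<lambda>i j. c (i, j)", simplified] by (rule sum.swap)
  also have "\<dots> \<le> (\<Sum>j<N. B j)" by (rule sum_mono[OF le])
  also have "\<dots> \<le> suminf B" by (rule sum_le_suminf[OF B]) (simp_all add: B0)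
  finally show "(\<Sum>n<N. c (prod_decode n)) \<le> suminf B" .
qed (rule nonneg)

section \<open>Multipliers of the weak product\<close>

context hilbert_function_space
begin

lemma summable_norm_products:
  assumes f: "\<And>i::nat. f i \<in> H" and g: "\<And>i. g i \<in> H"
    and s: "summable (\<lambda>i. nrm (f i) * nrm (g i))"
  shows "summable (\<lambda>i. norm (f i x * g i x))"
proof -
  obtain C where C: "\<And>f. f \<in> H \<Longrightarrow> cmod (f x) \<le> C * nrm f"
    using bounded_eval[of x] by blast
  show ?thesis
  proof (rule summable_comparison_test'[OF summable_mult[OF s, of "C * C"], where N = 0])
    fix n :: nat
    have "norm (norm (f n x * g n x)) \<le> (C * nrm (f n)) * (C * nrm (g n))"
      unfolding norm_mult real_norm_def abs_mult abs_norm_cancel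
      by (intro mult_mono C f g norm_ge_zero order_trans[OF norm_ge_zero C])
    then show "norm (norm (f n x * g n x)) \<le> C * C * (nrm (f n) * nrm (g n))"
      by (simp add: mult_ac)
  qed
qed

text \<open>For an element with factors \<open>a j\<close>, \<open>b j\<close>, the product with
  \<open>m\<close> is the double series of \<open>(f i * a j) * (g i * b j)\<close>. For fixed
  \<open>j\<close>, Cauchy-Schwarz in \<open>i\<close> and the two column bounds give at most
  \<open>nrm (a j) * nrm (b j)\<close>, which is summable.\<close>

lemma weak_product_multiplier:
  assumes f: "\<And>i::nat. f i \<in> H" and g: "\<And>i. g i \<in> H"
    and s: "summable (\<lambda>i. nrm (f i) * nrm (g i))" and sums: "\<And>x. (\<lambda>i. f i x * g i x) sums m x"
    and fh: "\<And>i h. h \<in> H \<Longrightarrow> (\<lambda>z. f i z * h z) \<in> H"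
    and gh: "\<And>i h. h \<in> H \<Longrightarrow> (\<lambda>z. g i z * h z) \<in> H"
    and f_col: "\<And>N h. h \<in> H \<Longrightarrow> (\<Sum>i<N. (nrm (\<lambda>z. f i z * h z))\<^sup>2) \<le> (nrm h)\<^sup>2"
    and g_col: "\<And>N h. h \<in> H \<Longrightarrow> (\<Sum>i<N. (nrm (\<lambda>z. g i z * h z))\<^sup>2) \<le> (nrm h)\<^sup>2"
  shows "m \<in> Mult (weak_product H ip)"
  unfolding Mult_def
proof (intro CollectI ballI)
  fix F assume "F \<in> weak_product H ip"
  then obtain a b where a: "\<And>j. a j \<in> H" and b: "\<And>j. b j \<in> H"
    and sab: "summable (\<lambda>j. nrm (a j) * nrm (b j))"
    and F: "\<And>x. (\<lambda>j. a j x * b j x) sums F x"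
    unfolding weak_product_def by blast
  define A where "A n = (\<lambda>z. f (fst (prod_decode n)) z * a (snd (prod_decode n)) z)" for n
  define B where "B n = (\<lambda>z. g (fst (prod_decode n)) z * b (snd (prod_decode n)) z)" for n
  have AB: "A n \<in> H" "B n \<in> H" for n by (simp_all add: A_def B_def fh gh a b)
  define c where "c x = nrm (\<lambda>z. f (fst x) z * a (snd x) z) * nrm (\<lambda>z. g (fst x) z * b (snd x) z)"
    for x :: "nat \<times> nat"
  have "summable (\<lambda>n. c (prod_decode n))"
  proof (rule summable_prod_decode[OF _ _ sab])
    show "0 \<le> c x" for x by (simp add: c_def nrm_nonneg fh gh a b)
    show "(\<Sum>i<N. c (i, j)) \<le> nrm (a j) * nrm (b j)" for j N
    proof -
      have "(\<Sum>i<N. c (i, j)) = (\<Sum>i<N. \<bar>nrm (\<lambda>z. f i z * a j z)\<bar> * \<bar>nrm (\<lambda>z. g i z * b j z)\<bar>)"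
        by (simp add: c_def nrm_nonneg fh gh a b)
      also have "\<dots> \<le> L2_set (\<lambda>i. nrm (\<lambda>z. f i z * a j z)) {..<N} * L2_set (\<lambda>i. nrm (\<lambda>z. g i z * b j z)) {..<N}"
        by (rule L2_set_mult_ineq)
      also have "\<dots> \<le> nrm (a j) * nrm (b j)"
        unfolding L2_set_def
        by (intro mult_mono real_le_lsqrt f_col g_col a b nrm_nonneg real_sqrt_ge_zero sum_nonneg zero_le_power2)
      finally show ?thesis .
    qed
  qed
  then have sum_c: "summable (\<lambda>n. nrm (A n) * nrm (B n))"
    by (simp add: c_def A_def B_def)
  have "(\<lambda>n. A n x * B n x) sums (m x * F x)" for x
    using sums_prod_decode[OF sums summable_norm_products[OF f g s] F summable_norm_products[OF a b sab], of x x]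
    by (simp add: A_def B_def mult_ac)
  then show "(\<lambda>x. m x * F x) \<in> weak_product H ip"
    unfolding weak_product_def using AB sum_c by blast
qed

end

section \<open>From the hypotheses on the kernel to the inclusion\<close>

lemma complete_Pick_space_exists:
  assumes "hilbert_function_space H ip" "reproducing_kernel H ip k" "normalized_complete_Pick k"
  shows "\<exists>u z0. complete_Pick_space H ip k u z0"
proof -
  obtain z0 u where "\<forall>z. k z z0 = 1" "positive_definite u"
    "\<forall>z w. u z w \<noteq> 1 \<and> k z w = 1 / (1 - u z w)"
    using assms(3) unfolding normalized_complete_Pick_def by blast
  then have "complete_Pick_space H ip k u z0"
    using assms(1,2)
    by (simp add: complete_Pick_space_def complete_Pick_space_axioms_def kernel_space_def
        kernel_space_axioms_def)
  then show ?thesis by blast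
qed

theorem theorem1p1:
  fixes H :: "('x \<Rightarrow> complex) set"
    and ip :: "('x \<Rightarrow> complex) \<Rightarrow> ('x \<Rightarrow> complex) \<Rightarrow> complex"
    and k :: "'x \<Rightarrow> 'x \<Rightarrow> complex"
  assumes "hilbert_function_space H ip"
    and "norm_separable H (hnorm ip)"
    and "reproducing_kernel H ip k"
    and "normalized_complete_Pick k"
  shows "weak_product H ip \<subseteq> Nplus_weak_product H ip"
proof
  obtain u z0 where "complete_Pick_space H ip k u z0"
    using complete_Pick_space_exists[OF assms(1,3,4)] by blast
  then interpret complete_Pick_space H ip k u z0 .
  fix h assume "h \<in> weak_product H ip"
  then obtain f\<^sub>0 g\<^sub>0 where f0: "\<And>i. f\<^sub>0 i \<in> H" and g0: "\<And>i. g\<^sub>0 i \<in> H"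
    and s0: "summable (\<lambda>i. nrm (f\<^sub>0 i) * nrm (g\<^sub>0 i))"
    and h0: "\<And>x. (\<lambda>i. f\<^sub>0 i x * g\<^sub>0 i x) sums h x"
    unfolding weak_product_def by blast
  \<comment> \<open>The factors are balanced first, since a common denominator requires a square
    summable sequence.\<close>
  have "\<forall>i. \<exists>f' g'. f' \<in> H \<and> g' \<in> H \<and> (\<forall>x. f' x * g' x = f\<^sub>0 i x * g\<^sub>0 i x) \<and>
    (nrm f')\<^sup>2 = nrm (f\<^sub>0 i) * nrm (g\<^sub>0 i) \<and> (nrm g')\<^sup>2 = nrm (f\<^sub>0 i) * nrm (g\<^sub>0 i)"
    by (intro allI balanced_factors f0 g0)
  then obtain f g where f: "\<And>i. f i \<in> H" and g: "\<And>i. g i \<in> H"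
    and fg: "\<And>i x. f i x * g i x = f\<^sub>0 i x * g\<^sub>0 i x"
    and nf: "\<And>i. (nrm (f i))\<^sup>2 = nrm (f\<^sub>0 i) * nrm (g\<^sub>0 i)"
    and ng: "\<And>i. (nrm (g i))\<^sup>2 = nrm (f\<^sub>0 i) * nrm (g\<^sub>0 i)"
    unfolding choice_iff by blast
  have sf: "summable (\<lambda>i. (nrm (f i))\<^sup>2)" and sg: "summable (\<lambda>i. (nrm (g i))\<^sup>2)"
    using s0 by (simp_all add: nf ng)
  obtain \<phi> where \<phi>: "accretive_multiplier \<phi>"
    and \<phi>f: "\<And>i h. h \<in> H \<Longrightarrow> (\<lambda>z. \<phi> z * f i z * h z) \<in> H"
    and \<phi>_col: "\<And>N h. h \<in> H \<Longrightarrow> (\<Sum>i<N. (nrm (\<lambda>z. \<phi> z * f i z * h z))\<^sup>2) \<le> (nrm h)\<^sup>2"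
    using common_denominator[OF f sf] by blast
  obtain \<psi> where \<psi>: "accretive_multiplier \<psi>"
    and \<psi>g: "\<And>i h. h \<in> H \<Longrightarrow> (\<lambda>z. \<psi> z * g i z * h z) \<in> H"
    and \<psi>_col: "\<And>N h. h \<in> H \<Longrightarrow> (\<Sum>i<N. (nrm (\<lambda>z. \<psi> z * g i z * h z))\<^sup>2) \<le> (nrm h)\<^sup>2"
    using common_denominator[OF g sg] by blast
  note D = accretive_multiplierD[OF \<phi>] accretive_multiplierD[OF \<psi>]
  \<comment> \<open>The numerator is the series of \<open>(\<phi> * f i) * (\<psi> * g i)\<close>:
    each denominator is absorbed by one family, which becomes a contractive column.\<close>
  have "(\<lambda>z. \<phi> z * \<psi> z * h z) \<in> Mult (weak_product H ip)"
  proof (rule weak_product_multiplier[of "\<lambda>i z. \<phi> z * f i z" "\<lambda>i z. \<psi> z * g i z"])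
    show "summable (\<lambda>i. nrm (\<lambda>z. \<phi> z * f i z) * nrm (\<lambda>z. \<psi> z * g i z))"
    proof (rule summable_comparison_test'[OF s0, where N = 0])
      fix n :: nat
      have "nrm (f n) * nrm (g n) = nrm (f\<^sub>0 n) * nrm (g\<^sub>0 n)"
      proof -
        have "nrm (f n) = nrm (g n)"
          using nf[of n] ng[of n] nrm_nonneg[OF f[of n]] nrm_nonneg[OF g[of n]]
          by (metis power2_eq_imp_eq)
        then show ?thesis using nf[of n] by (simp add: power2_eq_square)
      qed
      moreover have "nrm (\<lambda>z. \<phi> z * f n z) * nrm (\<lambda>z. \<psi> z * g n z) \<le> nrm (f n) * nrm (g n)"
        by (intro mult_mono D f g nrm_nonneg)
      ultimately show "norm (nrm (\<lambda>z. \<phi> z * f n z) * nrm (\<lambda>z. \<psi> z * g n z)) \<le> nrm (f\<^sub>0 n) * nrm (g\<^sub>0 n)"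
        by (simp add: nrm_nonneg D f g)
    qed
    show "(\<lambda>i. (\<phi> x * f i x) * (\<psi> x * g i x)) sums (\<phi> x * \<psi> x * h x)" for x
      using sums_mult[OF h0[of x], of "\<phi> x * \<psi> x"] by (simp add: fg[symmetric] mult_ac)
  qed (use D f g \<phi>f \<psi>g \<phi>_col \<psi>_col in auto)
  moreover have "(\<lambda>z. \<phi> z * \<psi> z) \<in> Mult H"
    by (simp add: Mult_def D mult.assoc)
  moreover have "cyclic H nrm (\<lambda>z. \<phi> z * \<psi> z)"
    by (rule cyclic_accretive_product[OF \<phi> \<psi>])
  moreover have "h = (\<lambda>z. (\<phi> z * \<psi> z * h z) / (\<phi> z * \<psi> z))"
    using D(1,5) by simp
  ultimately show "h \<in> Nplus_weak_product H ip"
    unfolding Nplus_weak_product_def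
    by (intro CollectI exI[of _ "\<lambda>z. \<phi> z * \<psi> z * h z"] exI[of _ "\<lambda>z. \<phi> z * \<psi> z"] conjI)
qed

end
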